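(* Let $h_1,h_2>0$, $\Omega=(-\frac{h_1}2,\frac{h_1}2)\times(-\frac{h_2}2,\frac{h_2}2)\subset\mathbb{R}^2$ and $\Gamma=\partial\Omega$. Then the smallest constant $C_2(\Omega,\Gamma)$ equals $$\left(\frac{2z_0(\alpha_0)}{\sqrt{h_1h_2}}\tanh\Big(\frac{z_0(\alpha_0)}{\alpha_0}\Big)\right)^{-\frac12},$$ where $\alpha_0=\sqrt{\frac{\max\{h_1;h_2\}}{\min\{h_1;h_2\}}}$ and, for $\alpha>0$, $z_0=z_0(\alpha)$ is the unique root of the equation $$\tanh\left(\frac z\alpha\right)\tan(z\alpha)=1$$ such that $0<z_0\alpha<\frac\pi2$.
   Context: For a bounded connected Lipschitz domain $\Omega\subset\mathbb{R}^d$ and a measurable part $\Gamma\subset\partial\Omega$ of positive $(d-1)$-dimensional measure, let $\widetilde H^1(\Omega,\Gamma)=\{w\in H^1(\Omega): \text{the mean value of (the trace of) } w \text{ on } \Gamma \text{ is zero}\}$. The norm in $L^2(\omega)$ is denoted $\|\cdot\|_{2,\omega}$. The sharp constant $C_2(\Omega,\Gamma)$ is the smallest constant $C$ such that $\|w\|_{2,\Gamma}\le C\|\nabla w\|_{2,\Omega}$ for all $w\in\widetilde H^1(\Omega,\Gamma)$. *)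

theory Defs
  imports "HOL-Analysis.Analysis"
begin

subsection \<open>Surface measure\<close>

text \<open>Normalised Hausdorff measure of integer dimension. Empty covering sets are given weight 0
  explicitly because \<open>0 ^ 0 = 1\<close>; boundedness is required because the library's
  \<open>diameter\<close> is meaningless for unbounded sets.\<close>

definition hausdorff_weight :: "nat \<Rightarrow> 'a::euclidean_space set \<Rightarrow> real" where
  "hausdorff_weight s U =
     (if U = {} then 0 else unit_ball_vol (real s) * (diameter U / 2) ^ s)"

definition hausdorff_delta :: "nat \<Rightarrow> real \<Rightarrow> 'a::euclidean_space set \<Rightarrow> ennreal" where
  "hausdorff_delta s \<delta> A =
     (INF U \<in> {U :: nat \<Rightarrow> 'a set.
                 A \<subseteq> (\<Union>i. U i) \<and> (\<forall>i. bounded (U i) \<and> diameter (U i) \<le> \<delta>)}.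
        \<Sum>i. ennreal (hausdorff_weight s (U i)))"

definition hausdorff_outer :: "nat \<Rightarrow> 'a::euclidean_space set \<Rightarrow> ennreal" where
  "hausdorff_outer s A = (SUP \<delta> \<in> {0<..}. hausdorff_delta s \<delta> A)"

text \<open>The Hausdorff outer measure is a metric outer measure, hence countably additive on the Borel
  sets, so \<open>measure_of\<close> does not fall back to the zero measure here. The completion is taken
  as in \<open>lebesgue = completion lborel\<close>.\<close>

definition surface_measure :: "'a::euclidean_space measure" where
  "surface_measure =
     completion (measure_of UNIV (sets borel) (hausdorff_outer (DIM('a) - 1)))"

subsection \<open>Square-integrable functions\<close>

definition L2_on :: "'a measure \<Rightarrow> 'a set \<Rightarrow> ('a \<Rightarrow> 'b::euclidean_space) \<Rightarrow> bool" where
  "L2_on M A f \<longleftrightarrow>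
     set_borel_measurable M A f \<and> set_integrable M A (\<lambda>x. (norm (f x))\<^sup>2)"

definition L2_norm_on :: "'a measure \<Rightarrow> 'a set \<Rightarrow> ('a \<Rightarrow> 'b::euclidean_space) \<Rightarrow> real" where
  "L2_norm_on M A f = sqrt (LINT x:A|M. (norm (f x))\<^sup>2)"

definition mean_value :: "'a measure \<Rightarrow> 'a set \<Rightarrow> ('a \<Rightarrow> real) \<Rightarrow> real" where
  "mean_value M A f = (LINT x:A|M. f x) / measure M A"

subsection \<open>Smooth functions and the Sobolev space\<close>

fun C_k :: "nat \<Rightarrow> ('a::euclidean_space \<Rightarrow> real) \<Rightarrow> bool" where
  "C_k 0 f \<longleftrightarrow> continuous_on UNIV f"
| "C_k (Suc k) f \<longleftrightarrow>
     (\<forall>x. f differentiable (at x)) \<and>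
     (\<forall>b\<in>Basis. C_k k (\<lambda>x. frechet_derivative f (at x) b))"

definition smooth :: "('a::euclidean_space \<Rightarrow> real) \<Rightarrow> bool" where
  "smooth f \<longleftrightarrow> (\<forall>k. C_k k f)"

definition test_function :: "'a::euclidean_space set \<Rightarrow> ('a \<Rightarrow> real) \<Rightarrow> bool" where
  "test_function \<Omega> \<phi> \<longleftrightarrow>
     smooth \<phi> \<and> (\<exists>K. compact K \<and> K \<subseteq> \<Omega> \<and> (\<forall>x. x \<notin> K \<longrightarrow> \<phi> x = 0))"

definition gradient :: "('a::euclidean_space \<Rightarrow> real) \<Rightarrow> 'a \<Rightarrow> 'a" where
  "gradient f x = (\<Sum>b\<in>Basis. frechet_derivative f (at x) b *\<^sub>R b)"

definition weak_gradient ::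
  "'a::euclidean_space set \<Rightarrow> ('a \<Rightarrow> real) \<Rightarrow> ('a \<Rightarrow> 'a) \<Rightarrow> bool" where
  "weak_gradient \<Omega> w g \<longleftrightarrow>
     (\<forall>\<phi>. test_function \<Omega> \<phi> \<longrightarrow>
        (LINT x:\<Omega>|lebesgue. w x *\<^sub>R gradient \<phi> x) = - (LINT x:\<Omega>|lebesgue. \<phi> x *\<^sub>R g x))"

text \<open>An element \<open>w\<close> of \<open>H\<^sup>1(\<Omega>)\<close> is always carried together with a representative \<open>g\<close> of its
  weak gradient, which is determined almost everywhere by \<open>w\<close>.\<close>

definition H1 :: "'a::euclidean_space set \<Rightarrow> (('a \<Rightarrow> real) \<times> ('a \<Rightarrow> 'a)) set" where
  "H1 \<Omega> = {(w, g). L2_on lebesgue \<Omega> w \<and> L2_on lebesgue \<Omega> g \<and> weak_gradient \<Omega> w g}"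

text \<open>The graph of the trace operator \<open>H\<^sup>1(\<Omega>) \<rightarrow> L\<^sup>2(\<partial>\<Omega>)\<close>: the closure of the restriction map
  \<open>u \<mapsto> u|\<partial>\<Omega>\<close> on functions smooth up to the boundary. On a bounded Lipschitz domain the latter are
  dense in \<open>H\<^sup>1(\<Omega>)\<close> and the restriction map is bounded, so every \<open>w\<close> has a trace, unique up to null
  sets.\<close>

definition has_trace ::
  "'a::euclidean_space set \<Rightarrow> ('a \<Rightarrow> real) \<times> ('a \<Rightarrow> 'a) \<Rightarrow> ('a \<Rightarrow> real) \<Rightarrow> bool" where
  "has_trace \<Omega> = (\<lambda>(w, g) \<tau>.
     (w, g) \<in> H1 \<Omega> \<and> L2_on surface_measure (frontier \<Omega>) \<tau> \<and>
     (\<exists>u :: nat \<Rightarrow> 'a \<Rightarrow> real.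
        (\<forall>n. smooth (u n)) \<and>
        (\<lambda>n. L2_norm_on lebesgue \<Omega> (\<lambda>x. u n x - w x)) \<longlonglongrightarrow> 0 \<and>
        (\<lambda>n. L2_norm_on lebesgue \<Omega> (\<lambda>x. gradient (u n) x - g x)) \<longlonglongrightarrow> 0 \<and>
        (\<lambda>n. L2_norm_on surface_measure (frontier \<Omega>) (\<lambda>x. u n x - \<tau> x)) \<longlonglongrightarrow> 0))"

subsection \<open>The sharp constant\<close>

definition trace_inequality ::
  "'a::euclidean_space set \<Rightarrow> 'a set \<Rightarrow> real \<Rightarrow> bool" where
  "trace_inequality \<Omega> \<Gamma> C \<longleftrightarrow>
     (\<forall>w g \<tau>. (w, g) \<in> H1 \<Omega> \<longrightarrow> has_trace \<Omega> (w, g) \<tau> \<longrightarrow> mean_value surface_measure \<Gamma> \<tau> = 0 \<longrightarrow>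
        L2_norm_on surface_measure \<Gamma> \<tau> \<le> C * L2_norm_on lebesgue \<Omega> g)"

definition is_C2 :: "'a::euclidean_space set \<Rightarrow> 'a set \<Rightarrow> real \<Rightarrow> bool" where
  "is_C2 \<Omega> \<Gamma> C \<longleftrightarrow>
     trace_inequality \<Omega> \<Gamma> C \<and> (\<forall>C'. trace_inequality \<Omega> \<Gamma> C' \<longrightarrow> C \<le> C')"

subsection \<open>The transcendental equation\<close>

definition is_z0 :: "real \<Rightarrow> real \<Rightarrow> bool" where
  "is_z0 \<alpha> z \<longleftrightarrow> tanh (z / \<alpha>) * tan (z * \<alpha>) = 1 \<and> 0 < z * \<alpha> \<and> z * \<alpha> < pi / 2"

definition z0 :: "real \<Rightarrow> real" where
  "z0 \<alpha> = (THE z. is_z0 \<alpha> z)"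

end

theory Submission
  imports Defs
begin

text \<open>Write \<open>a \<ge> b\<close> for the half-widths of the rectangle, let \<open>\<beta> > 0\<close> solve
  \<open>tanh (\<beta> b) tan (\<beta> a) = 1\<close> with \<open>\<beta> a < \<pi>/2\<close>, and put
  \<open>\<mu> = \<beta> tanh (\<beta> b) = \<beta> cot (\<beta> a)\<close>. With \<open>\<beta> = z0 / sqrt (a b)\<close> this \<open>\<mu>\<close> is the expression in the
  theorem, so the claim is that \<open>\<mu>\<close> is the first positive Steklov eigenvalue of the rectangle. The
  function \<open>sin (\<beta> x) cosh (\<beta> y)\<close> is harmonic, has normal derivative \<open>\<mu>\<close> times itself on every side and
  boundary mean zero; Green's identity makes it an equality case (\<open>trace_inequality_sharp\<close>).

  The substance is the inequality \<open>\<mu> \<integral>\<^sub>\<Gamma> u\<^sup>2 \<le> \<integral>\<^sub>\<Omega> |\<nabla>u|\<^sup>2\<close> for \<open>u\<close> with boundary mean zero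
  (\<open>rectangle_inequality\<close>), which is obtained without spectral theory. Split \<open>u\<close> into its four parts
  that are even or odd in \<open>x\<close> and in \<open>y\<close>. They are orthogonal for both quadratic forms, so the
  inequality may be proved for each part on the quarter \<open>[0,a] \<times> [0,b]\<close>.

  A part that is odd in \<open>x\<close> vanishes on \<open>x = 0\<close>. Completing the square with a solution
  \<open>g\<close> of \<open>g' = k - g\<^sup>2\<close> (\<open>Riccati_inequality\<close>) gives on horizontal and on vertical segments
  \<open>\<integral> f'\<^sup>2 \<ge> \<mu> f(a)\<^sup>2 + \<beta>\<^sup>2 \<integral> f\<^sup>2\<close> when \<open>f 0 = 0\<close>, by \<open>g = \<beta> cot (\<beta> x)\<close>, and
  \<open>\<integral> f'\<^sup>2 \<ge> \<mu> f(b)\<^sup>2 - \<beta>\<^sup>2 \<integral> f\<^sup>2\<close> for all \<open>f\<close>, by \<open>g = \<beta> tanh (\<beta> y)\<close>. Integrated over the other variable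
  and added, the terms with \<open>\<beta>\<^sup>2\<close> cancel. As \<open>b \<le> a\<close>, the same \<open>\<beta>\<close> serves for the parts that are odd in
  \<open>y\<close>. Only the even part uses the mean value condition, and for it there is room to spare:
  \<open>even_inequality\<close> separates the average over \<open>y\<close> from the remainder and applies crude estimates.

  The inequality passes from smooth functions to \<open>H\<^sup>1\<close> by the definition of the trace as a limit
  (\<open>trace_inequality_of_C1\<close>). This needs integrals over the boundary to be sums of four
  ordinary integrals, hence that Hausdorff measure is a measure on the Borel sets, by Caratheodory's
  criterion, and that it agrees with length on lines.\<close>

section \<open>Hausdorff measure is a Borel measure\<close>

text \<open>Only the inequality \<open>m (A \<inter> F) + m (A - F) \<le> m A\<close> with \<open>m A\<close> finite needs an argument. The part of
  \<open>A\<close> at distance at least \<open>1 / (n + 1)\<close> from \<open>F\<close> is separated from \<open>A \<inter> F\<close>, so additivity holds for it;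
  it remains to see that its measure exhausts that of \<open>A - F\<close>. The rest of \<open>A - F\<close> is a union of
  shells. Shells of even index are separated from each other, and so are those of odd index; hence
  the measures of all shells have sum at most \<open>2 m A\<close>, and the tails of this series vanish.\<close>

lemma metric_outer_measure_closed:
  fixes m :: "'a::metric_space set \<Rightarrow> ennreal"
  assumes oms: "outer_measure_space UNIV m"
    and metric: "\<And>A B d. 0 < d \<Longrightarrow> (\<And>x y. x \<in> A \<Longrightarrow> y \<in> B \<Longrightarrow> d \<le> dist x y) \<Longrightarrow> m A + m B \<le> m (A \<union> B)"
    and F: "closed F"
  shows "F \<in> lambda_system UNIV UNIV m"
proof -
  have mono: "m A \<le> m B" if "A \<subseteq> B" for A B
    using oms that by (auto simp: outer_measure_space_def increasing_def)
  have m0: "m {} = 0" using oms by (auto simp: outer_measure_space_def positive_def)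
  have csub: "m (\<Union>i. A i) \<le> (\<Sum>i. m (A i))" for A :: "nat \<Rightarrow> 'a set"
  proof -
    have "m (\<Union>i. A i) = m (\<Union>i. disjointed A i)" by (simp add: UN_disjointed_eq)
    also have "\<dots> \<le> (\<Sum>i. m (disjointed A i))"
      using oms disjoint_family_disjointed[of A]
      by (auto simp: outer_measure_space_def countably_subadditive_def)
    also have "\<dots> \<le> (\<Sum>i. m (A i))"
      by (intro suminf_le mono disjointed_subset) auto
    finally show ?thesis .
  qed
  have sub2: "m (A \<union> B) \<le> m A + m B" for A B
  proof -
    have "m (A \<union> B) = m (\<Union>i. binaryset A B i)" by (simp add: UN_binaryset_eq)
    also have "\<dots> \<le> (\<Sum>i. m (binaryset A B i))" by (rule csub)
    also have "\<dots> = m A + m B" by (rule suminf_binaryset_eq) (rule m0)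
    finally show ?thesis .
  qed
  have key: "m (A \<inter> F) + m (A - F) \<le> m A" if ne: "F \<noteq> {}" for A
  proof (cases "m A = \<infinity>")
    case False
    then have fin: "m A < top" by (simp add: top.not_eq_extremum)
    define G where "G n = {x\<in>A. 1 / (real n + 1) \<le> infdist x F}" for n
    define D where "D n = G (Suc n) - G n" for n
    define g where "g n = enn2real (m (D n))" for n
    have DA: "m (D n) \<le> m A" for n by (rule mono) (auto simp: D_def G_def)
    then have mD: "m (D n) = ennreal (g n)" for n
      unfolding g_def using order_le_less_trans[OF DA fin] by simp
    have gnn: "0 \<le> g n" for n by (simp add: g_def)
    have step: "infdist x F - infdist y F \<le> dist x y" for x y
      using infdist_triangle[of x F y] by simp
    \<comment> \<open>Shells whose indices differ by two are separated, which allows additivity to be iterated.\<close>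
    have dsum: "(\<Sum>k<n. m (D (2*k+i))) \<le> m (\<Union>k<n. D (2*k+i))" for n i
    proof (induction n)
      case (Suc n)
      have "m (\<Union>k<n. D (2*k+i)) + m (D (2*n+i)) \<le> m ((\<Union>k<n. D (2*k+i)) \<union> D (2*n+i))"
      proof (cases "n = 0")
        case False
        show ?thesis
        proof (rule metric)
          show "0 < 1 / (2 * real n + real i) - 1 / (2 * real n + real i + 1)"
            unfolding diff_gt_0_iff_gt
            using False by (intro divide_strict_left_mono mult_pos_pos) simp_all
          fix x y assume "x \<in> (\<Union>k<n. D (2*k+i))" and y: "y \<in> D (2*n+i)"
          then obtain k where k: "k < n" "x \<in> D (2*k+i)" by auto
          have "1 / (2 * real n + real i) \<le> 1 / (real (Suc (2*k+i)) + 1)"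
            using k by (intro divide_left_mono) (auto simp: mult_pos_pos)
          also have "\<dots> \<le> infdist x F" using k by (simp add: D_def G_def)
          finally have 1: "1 / (2 * real n + real i) \<le> infdist x F" .
          have "infdist y F < 1 / (2 * real n + real i + 1)"
            using y by (auto simp: D_def G_def)
          then show "1 / (2 * real n + real i) - 1 / (2 * real n + real i + 1) \<le> dist x y"
            using 1 step[of x y] by linarith
        qed
      qed (simp add: m0)
      moreover have "(\<Union>k<Suc n. D (2*k+i)) = (\<Union>k<n. D (2*k+i)) \<union> D (2*n+i)"
        by (auto simp: lessThan_Suc)
      ultimately show ?case
        using order_trans[OF add_right_mono[OF Suc.IH]] by simp
    qed (simp add: m0)
    have bound: "(\<Sum>k<n. g (2*k+i)) \<le> enn2real (m A)" for n i
    proof -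
      have "ennreal (\<Sum>k<n. g (2*k+i)) = (\<Sum>k<n. m (D (2*k+i)))"
        by (simp add: mD gnn)
      also have "\<dots> \<le> m (\<Union>k<n. D (2*k+i))" by (rule dsum)
      also have "\<dots> \<le> m A" by (rule mono) (auto simp: D_def G_def)
      finally have "enn2real (ennreal (\<Sum>k<n. g (2*k+i))) \<le> enn2real (m A)"
        using fin by (rule enn2real_mono)
      then show ?thesis by (simp add: gnn sum_nonneg)
    qed
    \<comment> \<open>The even and the odd shells each contribute at most the measure of \<open>A\<close>.\<close>
    have "summable g"
    proof (rule summableI_nonneg_bounded)
      show "0 \<le> g n" for n by (rule gnn)
      fix n
      have "sum g {..<n} \<le> sum g {..<2*n}"
        by (rule sum_mono2) (auto simp: gnn)
      also have "\<dots> = (\<Sum>k<n. g (2*k+0)) + (\<Sum>k<n. g (2*k+1))"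
        by (induction n) auto
      also have "\<dots> \<le> enn2real (m A) + enn2real (m A)"
        by (intro add_mono bound)
      finally show "sum g {..<n} \<le> enn2real (m A) + enn2real (m A)" .
    qed
    then have tail: "(\<lambda>n. \<Sum>k. g (k + n)) \<longlonglongrightarrow> 0" and sm: "\<And>n. summable (\<lambda>k. g (k+n))"
      by (rule suminf_exist_split2) (simp add: \<open>summable g\<close> summable_ignore_initial_segment)
    have part: "m (A \<inter> F) + m (A - F) \<le> m A + ennreal (\<Sum>k. g (k + n))" for n
    proof -
      have "A - F \<subseteq> G n \<union> (\<Union>k. D (k + n))"
      proof
        fix x assume x: "x \<in> A - F"
        then have "infdist x F > 0"
          using in_closed_iff_infdist_zero[OF F ne, of x] infdist_nonneg[of x F] by auto
        then obtain N where N: "inverse (real (Suc N)) < infdist x F"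
          using reals_Archimedean by blast
        then have ex: "x \<in> G N" using x by (auto simp: G_def inverse_eq_divide add.commute)
        show "x \<in> G n \<union> (\<Union>k. D (k + n))"
        proof (cases "x \<in> G n")
          case False
          \<comment> \<open>The first index from which on the point is far enough away determines its shell.\<close>
          define l where "l = (LEAST l. x \<in> G l)"
          have l: "x \<in> G l" "\<And>j. j < l \<Longrightarrow> x \<notin> G j"
            unfolding l_def using ex by (auto intro: LeastI dest: not_less_Least)
          have "n < l"
          proof (rule ccontr)
            assume "\<not> n < l"
            then have "1 / (real n + 1) \<le> 1 / (real l + 1)" by (intro divide_left_mono) auto
            then show False using l(1) False by (auto simp: G_def)
          qed
          then have "l = Suc ((l - Suc n) + n)" by simp
          then obtain k where "l = Suc (k + n)" by blast
          then have "x \<in> D (k + n)" using l by (simp add: D_def)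
          then show ?thesis by blast
        qed simp
      qed
      then have "m (A - F) \<le> m (G n) + (\<Sum>k. m (D (k + n)))"
        by (intro order_trans[OF mono order_trans[OF sub2 add_left_mono[OF csub]]])
      also have "(\<Sum>k. m (D (k + n))) = ennreal (\<Sum>k. g (k + n))"
        unfolding mD by (rule suminf_ennreal2) (auto simp: sm gnn \<open>summable g\<close>)
      finally have "m (A \<inter> F) + m (A - F) \<le> (m (A \<inter> F) + m (G n)) + ennreal (\<Sum>k. g (k + n))"
        by (simp add: add.assoc add_left_mono)
      also have "m (A \<inter> F) + m (G n) \<le> m ((A \<inter> F) \<union> G n)"
      proof (rule metric[of "1 / (real n + 1)"])
        fix x y assume "x \<in> A \<inter> F" "y \<in> G n"
        then show "1 / (real n + 1) \<le> dist x y"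
          using infdist_le[of x F y] by (auto simp: G_def dist_commute)
      qed simp
      also have "m ((A \<inter> F) \<union> G n) \<le> m A" by (rule mono) (auto simp: G_def)
      finally show ?thesis by (simp add: add_right_mono)
    qed
    have "(\<lambda>n. m A + ennreal (\<Sum>k. g (k + n))) \<longlonglongrightarrow> m A + ennreal 0"
      by (intro tendsto_add tendsto_const tendsto_ennrealI tail)
    then show ?thesis using part by (intro LIMSEQ_le_const) auto
  qed simp
  have eq: "m (F \<inter> A) + m (- F \<inter> A) = m A" for A
  proof (cases "F = {}")
    case True then show ?thesis by (simp add: m0)
  next
    case False
    show ?thesis
    proof (rule antisym)
      show "m (F \<inter> A) + m (- F \<inter> A) \<le> m A"
        using key[OF False, of A] by (simp add: Int_commute Diff_eq)
      have "A = (F \<inter> A) \<union> (- F \<inter> A)" by auto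
      then show "m A \<le> m (F \<inter> A) + m (- F \<inter> A)" using sub2 by metis
    qed
  qed
  then show ?thesis by (simp add: lambda_system_def Compl_eq_Diff_UNIV)
qed

lemma metric_outer_measure_borel:
  fixes m :: "'a::metric_space set \<Rightarrow> ennreal"
  assumes oms: "outer_measure_space UNIV m"
    and metric: "\<And>A B d. 0 < d \<Longrightarrow> (\<And>x y. x \<in> A \<Longrightarrow> y \<in> B \<Longrightarrow> d \<le> dist x y) \<Longrightarrow> m A + m B \<le> m (A \<union> B)"
  shows "measure_space UNIV (sets borel) m"
proof -
  interpret P: sigma_algebra UNIV "UNIV :: 'a set set"
    using sigma_algebra_Pow[of UNIV] by simp
  have ms: "measure_space UNIV (lambda_system UNIV UNIV m) m"
    by (rule P.caratheodory_lemma[OF oms])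
  then have "sigma_algebra UNIV (lambda_system UNIV UNIV m)"
    by (simp add: measure_space_def)
  then have "sigma_sets UNIV (Collect closed) \<subseteq> lambda_system UNIV UNIV m"
    by (rule sigma_algebra.sigma_sets_subset) (auto intro: metric_outer_measure_closed[OF oms metric])
  then have "sets borel \<subseteq> lambda_system UNIV UNIV m"
    by (simp add: borel_eq_closed)
  then show ?thesis
    using measure_down[OF ms] sets.sigma_algebra_axioms[of borel] by (metis space_borel)
qed

lemma hausdorff_delta_le:
  assumes "A \<subseteq> (\<Union>i. U i)" "\<And>i. bounded (U i)" "\<And>i. diameter (U i) \<le> \<delta>"
  shows "hausdorff_delta s \<delta> A \<le> (\<Sum>i. ennreal (hausdorff_weight s (U i)))"
  unfolding hausdorff_delta_def using assms by (intro INF_lower) auto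

lemma hausdorff_delta_greatest:
  assumes "\<And>U. A \<subseteq> (\<Union>i. U i) \<Longrightarrow> (\<And>i. bounded (U i)) \<Longrightarrow> (\<And>i. diameter (U i) \<le> \<delta>) \<Longrightarrow>
     r \<le> (\<Sum>i. ennreal (hausdorff_weight s (U i)))"
  shows "r \<le> hausdorff_delta s \<delta> A"
  unfolding hausdorff_delta_def using assms by (intro INF_greatest) auto

lemma hausdorff_delta_mono:
  assumes "A \<subseteq> B" "\<delta>' \<le> \<delta>"
  shows "hausdorff_delta s \<delta> A \<le> hausdorff_delta s \<delta>' B"
  using assms(1) order_trans[OF _ assms(2)]
  by (intro hausdorff_delta_greatest hausdorff_delta_le) auto

lemma hausdorff_delta_empty: "\<delta> > 0 \<Longrightarrow> hausdorff_delta s \<delta> {} = 0"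
  using hausdorff_delta_le[of "{}" "\<lambda>_. {}" \<delta> s] by (simp add: hausdorff_weight_def)

text \<open>Coverings that are optimal up to \<open>e / 2\<^sup>n\<^sup>+\<^sup>1\<close> for the \<open>n\<close>-th set are merged into one sequence by the
  pairing function.\<close>

lemma hausdorff_delta_countably_subadditive:
  "hausdorff_delta s \<delta> (\<Union>n. A n) \<le> (\<Sum>n. hausdorff_delta s \<delta> (A n))"
proof (rule ennreal_le_epsilon)
  fix e :: real assume e: "0 < e" and fin: "(\<Sum>n. hausdorff_delta s \<delta> (A n)) < top"
  let ?H = "hausdorff_delta s \<delta>" and ?w = "\<lambda>U. ennreal (hausdorff_weight s U)"
  have "?H (A n) < ?H (A n) + e * (1/2)^Suc n" for n
    using fin e by (auto simp add: less_top dest!: ennreal_suminf_lessD)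
  then have less: "(INF U \<in> {U. A n \<subseteq> (\<Union>i. U i) \<and> (\<forall>i. bounded (U i) \<and> diameter (U i) \<le> \<delta>)}.
      \<Sum>i. ?w (U i)) < ?H (A n) + e * (1/2)^Suc n" for n
    by (simp add: hausdorff_delta_def)
  have "\<exists>U. A n \<subseteq> (\<Union>i. U i) \<and> (\<forall>i. bounded (U i) \<and> diameter (U i) \<le> \<delta>)
      \<and> (\<Sum>i. ?w (U i)) \<le> ?H (A n) + e * (1/2)^Suc n" for n
    using less[of n, unfolded INF_less_iff] by (auto intro: less_imp_le)
  then obtain B where B: "\<And>n. A n \<subseteq> (\<Union>i. B n i)" "\<And>n i. bounded (B n i)"
      "\<And>n i. diameter (B n i) \<le> \<delta>" "\<And>n. (\<Sum>i. ?w (B n i)) \<le> ?H (A n) + e * (1/2)^Suc n"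
    by metis
  define C where "C = case_prod B o prod_decode"
  have "(\<Union>n. A n) \<subseteq> (\<Union>i. C i)"
    using B(1) by (auto simp add: C_def subset_eq) (metis prod.case prod_encode_inverse)
  then have "?H (\<Union>n. A n) \<le> (\<Sum>i. ?w (C i))"
    using B(2,3) by (intro hausdorff_delta_le) (auto simp: C_def split: prod.split)
  also have "\<dots> = (\<Sum>n. \<Sum>i. ?w (B n i))"
    unfolding C_def comp_def
    by (rule suminf_ennreal_2dimen[where f = "\<lambda>p. ?w (case_prod B p)"]) simp
  also have "\<dots> \<le> (\<Sum>n. ?H (A n) + e * (1/2) ^ Suc n)"
    by (intro suminf_le B) auto
  also have "... = (\<Sum>n. ?H (A n)) + (\<Sum>n. ennreal e * ennreal ((1/2) ^ Suc n))"
    using e by (subst suminf_add[symmetric])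
      (auto simp del: ennreal_suminf_cmult simp add: ennreal_mult[symmetric])
  also have "\<dots> = (\<Sum>n. ?H (A n)) + e"
    unfolding ennreal_suminf_cmult
    by (subst suminf_ennreal_eq[OF zero_le_power power_half_series]) auto
  finally show "?H (\<Union>n. A n) \<le> (\<Sum>n. ?H (A n)) + e" .
qed

lemma hausdorff_delta_le_outer: "0 < \<delta> \<Longrightarrow> hausdorff_delta s \<delta> A \<le> hausdorff_outer s A"
  unfolding hausdorff_outer_def by (rule SUP_upper) simp

lemma hausdorff_outer_least:
  "(\<And>\<delta>. 0 < \<delta> \<Longrightarrow> hausdorff_delta s \<delta> A \<le> r) \<Longrightarrow> hausdorff_outer s A \<le> r"
  unfolding hausdorff_outer_def by (rule SUP_least) simp

lemma hausdorff_outer_outer_measure: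
  "outer_measure_space UNIV (hausdorff_outer s :: 'a::euclidean_space set \<Rightarrow> ennreal)"
  unfolding outer_measure_space_def
proof (intro conjI)
  show "positive UNIV (hausdorff_outer s)"
    unfolding positive_def
    by (metis hausdorff_delta_empty hausdorff_outer_least le_zero_eq order_refl)
  show "increasing UNIV (hausdorff_outer s)"
    unfolding increasing_def
    by (meson hausdorff_delta_le_outer hausdorff_delta_mono hausdorff_outer_least order_refl order_trans)
  show "countably_subadditive UNIV (hausdorff_outer s)"
    unfolding countably_subadditive_def
  proof (intro allI impI, goal_cases)
    case (1 A)
    show ?case
    proof (rule hausdorff_outer_least)
      fix \<delta> :: real assume "0 < \<delta>"
      then show "hausdorff_delta s \<delta> (\<Union>i. A i) \<le> (\<Sum>i. hausdorff_outer s (A i))"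
        by (intro order_trans[OF hausdorff_delta_countably_subadditive] suminf_le
             hausdorff_delta_le_outer) auto
    qed
  qed
qed

text \<open>A set of diameter less than \<open>d\<close> cannot meet both \<open>A\<close> and \<open>B\<close>, so a fine covering of the union splits
  into a covering of \<open>A\<close> and one of \<open>B\<close>. Replacing the discarded sets by the empty set costs nothing
  because the empty set has weight zero.\<close>

lemma hausdorff_delta_separated:
  fixes A B :: "'a::euclidean_space set"
  assumes "\<delta> < d" and sep: "\<And>x y. x \<in> A \<Longrightarrow> y \<in> B \<Longrightarrow> d \<le> dist x y" and "0 < \<delta>"
  shows "hausdorff_delta s \<delta> A + hausdorff_delta s \<delta> B \<le> hausdorff_delta s \<delta> (A \<union> B)"
proof (rule hausdorff_delta_greatest)
  fix U :: "nat \<Rightarrow> 'a set" assume U: "A \<union> B \<subseteq> (\<Union>i. U i)" "\<And>i. bounded (U i)" "\<And>i. diameter (U i) \<le> \<delta>"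
  define V where "V i = (if U i \<inter> A = {} then {} else U i)" for i
  define W where "W i = (if U i \<inter> A = {} then U i else {})" for i
  have "A \<subseteq> (\<Union>i. V i)" using U(1) by (force simp: V_def)
  then have V: "hausdorff_delta s \<delta> A \<le> (\<Sum>i. ennreal (hausdorff_weight s (V i)))"
    using U assms(3) by (intro hausdorff_delta_le) (auto simp: V_def)
  have "B \<subseteq> (\<Union>i. W i)"
  proof
    fix y assume y: "y \<in> B"
    then obtain i where i: "y \<in> U i" using U by auto
    have "x \<notin> A" if "x \<in> U i" for x
    proof
      assume "x \<in> A"
      from sep[OF this y] diameter_bounded_bound[OF U(2) that i] U(3)[of i] assms(1)
      show False by linarith
    qed
    then have "y \<in> W i" using i by (auto simp: W_def)
    then show "y \<in> (\<Union>i. W i)" by blast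
  qed
  then have W: "hausdorff_delta s \<delta> B \<le> (\<Sum>i. ennreal (hausdorff_weight s (W i)))"
    using U assms(3) by (intro hausdorff_delta_le) (auto simp: W_def)
  have "(\<Sum>i. ennreal (hausdorff_weight s (V i))) + (\<Sum>i. ennreal (hausdorff_weight s (W i)))
      = (\<Sum>i. ennreal (hausdorff_weight s (U i)))"
    by (subst suminf_add[OF summableI summableI])
       (auto intro!: suminf_cong simp: V_def W_def hausdorff_weight_def)
  with add_mono[OF V W] show "hausdorff_delta s \<delta> A + hausdorff_delta s \<delta> B
      \<le> (\<Sum>i. ennreal (hausdorff_weight s (U i)))" by simp
qed

lemma hausdorff_outer_metric:
  assumes "0 < d" and sep: "\<And>x y. x \<in> A \<Longrightarrow> y \<in> B \<Longrightarrow> d \<le> dist x y"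
  shows "hausdorff_outer s A + hausdorff_outer s B \<le> hausdorff_outer s (A \<union> B)"
proof -
  have 1: "hausdorff_delta s \<delta> A + hausdorff_delta s \<delta>' B \<le> hausdorff_outer s (A \<union> B)"
    if "0 < \<delta>" "0 < \<delta>'" for \<delta> \<delta>'
  proof -
    define \<epsilon> where "\<epsilon> = min (min \<delta> \<delta>') (d / 2)"
    have \<epsilon>: "0 < \<epsilon>" "\<epsilon> < d" "\<epsilon> \<le> \<delta>" "\<epsilon> \<le> \<delta>'" using assms(1) that by (auto simp: \<epsilon>_def)
    have "hausdorff_delta s \<delta> A + hausdorff_delta s \<delta>' B
        \<le> hausdorff_delta s \<epsilon> A + hausdorff_delta s \<epsilon> B"
      using \<epsilon> by (intro add_mono hausdorff_delta_mono) auto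
    also have "\<dots> \<le> hausdorff_delta s \<epsilon> (A \<union> B)"
      using \<epsilon> sep by (intro hausdorff_delta_separated) auto
    also have "\<dots> \<le> hausdorff_outer s (A \<union> B)" using \<epsilon> by (intro hausdorff_delta_le_outer)
    finally show ?thesis .
  qed
  have ne: "{0::real<..} \<noteq> {}" by (metis greaterThan_non_empty)
  have "hausdorff_delta s \<delta> A + hausdorff_outer s B \<le> hausdorff_outer s (A \<union> B)" if "0 < \<delta>" for \<delta>
    unfolding hausdorff_outer_def[of s B]
    by (subst ennreal_SUP_add_right[OF ne]) (rule SUP_least, simp add: 1 that)
  then show ?thesis
    unfolding hausdorff_outer_def[of s A]
    by (subst ennreal_SUP_add_left[OF ne, symmetric]) (rule SUP_least, simp)
qed

text \<open>The measure whose completion is \<open>surface_measure\<close>.\<close>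

definition hausdorff_borel :: "'a::euclidean_space measure" where
  "hausdorff_borel = measure_of UNIV (sets borel) (hausdorff_outer (DIM('a) - 1))"

lemma sets_hausdorff_borel [simp, measurable_cong]: "sets hausdorff_borel = sets borel"
  by (simp add: hausdorff_borel_def sets.sigma_sets_eq[of borel, simplified])

lemma space_hausdorff_borel [simp]: "space hausdorff_borel = UNIV"
  by (simp add: hausdorff_borel_def)

text \<open>Without countable additivity on the Borel sets \<open>measure_of\<close> would yield the zero measure; this is
  where the metric property of the Hausdorff outer measure enters.\<close>

lemma emeasure_hausdorff_borel:
  fixes B :: "'a::euclidean_space set"
  assumes "B \<in> sets borel"
  shows "emeasure hausdorff_borel B = hausdorff_outer (DIM('a) - 1) B"
proof -
  have "measure_space UNIV (sets borel) (hausdorff_outer (DIM('a) - 1) :: 'a set \<Rightarrow> _)"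
    by (rule metric_outer_measure_borel[OF hausdorff_outer_outer_measure])
       (rule hausdorff_outer_metric)
  then show ?thesis
    unfolding hausdorff_borel_def using assms
    by (intro emeasure_measure_of_sigma) (auto simp: measure_space_def)
qed

section \<open>Length on lines and on the boundary of a rectangle\<close>

lemma hausdorff_weight_1: "U \<noteq> {} \<Longrightarrow> hausdorff_weight 1 U = diameter U"
  by (simp add: hausdorff_weight_def)

text \<open>Pulled back along the isometry, each covering set lies in a closed interval whose length is at
  most the diameter of the set.\<close>

lemma lborel_le_hausdorff_delta:
  fixes \<iota> :: "real \<Rightarrow> 'a::euclidean_space"
  assumes iso: "\<And>x y. dist (\<iota> x) (\<iota> y) = dist x y" and B: "B \<in> sets borel"
  shows "emeasure lborel B \<le> hausdorff_delta 1 \<delta> (\<iota> ` B)"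
proof (rule hausdorff_delta_greatest)
  fix U :: "nat \<Rightarrow> 'a set"
  assume U: "\<iota> ` B \<subseteq> (\<Union>i. U i)" "\<And>i. bounded (U i)" "\<And>i. diameter (U i) \<le> \<delta>"
  define V where "V i = (if \<iota> -` U i = {} then {} else {Inf (\<iota> -` U i)..Sup (\<iota> -` U i)})" for i
  have dist: "\<bar>x - y\<bar> \<le> diameter (U i)" if "x \<in> \<iota> -` U i" "y \<in> \<iota> -` U i" for x y i
    using diameter_bounded_bound[OF U(2), of "\<iota> x" i "\<iota> y"] that by (simp add: iso dist_real_def)
  have bdd: "bdd_above (\<iota> -` U i)" "bdd_below (\<iota> -` U i)" for i
  proof -
    show "bdd_above (\<iota> -` U i)"
    proof (cases "\<iota> -` U i = {}")
      case False
      then obtain y where y: "y \<in> \<iota> -` U i" by blast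
      show ?thesis
        by (rule bdd_aboveI[of _ "y + diameter (U i)"]) (use dist[OF _ y] in fastforce)
    qed simp
    show "bdd_below (\<iota> -` U i)"
    proof (cases "\<iota> -` U i = {}")
      case False
      then obtain y where y: "y \<in> \<iota> -` U i" by blast
      show ?thesis
        by (rule bdd_belowI[of _ "y - diameter (U i)"]) (use dist[OF _ y] in fastforce)
    qed simp
  qed
  have "B \<subseteq> (\<Union>i. V i)"
  proof
    fix x assume "x \<in> B"
    then obtain i where i: "x \<in> \<iota> -` U i" using U(1) by auto
    then have "x \<in> V i" using bdd[of i] by (auto simp: V_def intro: cInf_lower cSup_upper)
    then show "x \<in> (\<Union>i. V i)" by blast
  qed
  moreover have Vm: "V i \<in> sets lborel" for i by (simp add: V_def)
  ultimately have "emeasure lborel B \<le> emeasure lborel (\<Union>i. V i)"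
    by (intro emeasure_mono) auto
  also have "\<dots> \<le> (\<Sum>i. emeasure lborel (V i))"
    using Vm by (intro emeasure_subadditive_countably) auto
  also have "\<dots> \<le> (\<Sum>i. ennreal (hausdorff_weight 1 (U i)))"
  proof (intro suminf_le summableI)
    fix i
    show "emeasure lborel (V i) \<le> ennreal (hausdorff_weight 1 (U i))"
    proof (cases "\<iota> -` U i = {}")
      case False
      have "Sup (\<iota> -` U i) \<le> Inf (\<iota> -` U i) + diameter (U i)"
      proof (rule cSup_least[OF False])
        fix x assume x: "x \<in> \<iota> -` U i"
        have "x - diameter (U i) \<le> Inf (\<iota> -` U i)"
          by (rule cInf_greatest[OF False]) (use dist[OF x] in fastforce)
        then show "x \<le> Inf (\<iota> -` U i) + diameter (U i)" by simp
      qed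
      moreover have "Inf (\<iota> -` U i) \<le> Sup (\<iota> -` U i)"
        using bdd[of i] False by (intro cInf_le_cSup) auto
      moreover have "U i \<noteq> {}" using False by auto
      ultimately show ?thesis using False
        by (auto simp: V_def hausdorff_weight_1[simplified] intro!: ennreal_leI)
    qed (simp add: V_def)
  qed
  finally show "emeasure lborel B \<le> (\<Sum>i. ennreal (hausdorff_weight 1 (U i)))" .
qed

text \<open>Subdivision into equal pieces of length at most \<open>\<delta>\<close> is a covering whose total weight is the length.\<close>

lemma hausdorff_delta_segment_le:
  fixes \<iota> :: "real \<Rightarrow> 'a::euclidean_space"
  assumes iso: "\<And>x y. dist (\<iota> x) (\<iota> y) = dist x y" and lu: "l < u" and \<delta>: "0 < \<delta>"
  shows "hausdorff_delta 1 \<delta> (\<iota> ` {l<..<u}) \<le> ennreal (u - l)"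
proof -
  obtain n :: nat where n: "(u - l) / \<delta> < real n" using reals_Archimedean2 by blast
  have n0: "0 < real n" using n lu \<delta> by (meson divide_pos_pos diff_gt_0_iff_gt order_less_trans)
  define h where "h = (u - l) / real n"
  have h: "0 < h" "h \<le> \<delta>" "real n * h = u - l" using n n0 lu \<delta> by (auto simp: h_def field_simps)
  define U where "U i = (if i < n then \<iota> ` {l + real i * h..l + real (Suc i) * h} else {})" for i
  have diam: "bounded (U i) \<and> diameter (U i) \<le> h" for i
  proof (cases "i < n")
    case True
    have "dist x y \<le> h" if "x \<in> U i" "y \<in> U i" for x y
      using that True by (auto simp: U_def iso dist_real_def algebra_simps)
    then have "norm (x - y) \<le> h" if "x \<in> U i" "y \<in> U i" for x y
      using that by (simp add: dist_norm)
    moreover from this have "bounded (U i)"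
      unfolding bounded_two_points dist_norm by blast
    ultimately show ?thesis using h by (auto intro!: diameter_le)
  qed (use h in \<open>simp add: U_def\<close>)
  have "\<iota> ` {l<..<u} \<subseteq> (\<Union>i. U i)"
  proof
    fix z assume "z \<in> \<iota> ` {l<..<u}"
    then obtain x where x: "z = \<iota> x" "l < x" "x < u" by auto
    define i where "i = nat \<lfloor>(x - l) / h\<rfloor>"
    have "0 \<le> (x - l) / h" using x h by simp
    then have "real i \<le> (x - l) / h" "(x - l) / h < real i + 1" unfolding i_def by linarith+
    then have i: "real i * h \<le> x - l" "x - l < (real i + 1) * h" using h by (simp_all add: field_simps)
    have "real i * h < real n * h" using i(1) x h by simp
    then have "i < n" using h(1) by (simp only: mult_less_cancel_right_pos of_nat_less_iff)
    then have "z \<in> U i" using i x by (auto simp: U_def add.commute)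
    then show "z \<in> (\<Union>i. U i)" by blast
  qed
  then have "hausdorff_delta 1 \<delta> (\<iota> ` {l<..<u}) \<le> (\<Sum>i. ennreal (hausdorff_weight 1 (U i)))"
    using diam h by (intro hausdorff_delta_le) (auto intro: order_trans)
  also have "\<dots> = (\<Sum>i<n. ennreal (hausdorff_weight 1 (U i)))"
    by (rule suminf_finite) (auto simp: U_def hausdorff_weight_def)
  also have "\<dots> \<le> (\<Sum>i<n. ennreal h)"
    using diam h by (intro sum_mono ennreal_leI) (auto simp: hausdorff_weight_def)
  also have "\<dots> = ennreal (u - l)" using h by (simp add: ennreal_of_nat_eq_real_of_nat flip: ennreal_mult)
  finally show ?thesis .
qed

text \<open>The retraction \<open>p\<close> makes images of Borel sets under \<open>\<iota>\<close> measurable and allows the measure on the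
  line to be transported to the real axis. In dimension two the surface measure has dimension one.\<close>

locale isometric_line =
  fixes \<iota> :: "real \<Rightarrow> 'a::euclidean_space" and p :: "'a \<Rightarrow> real"
  assumes iso: "\<And>x y. dist (\<iota> x) (\<iota> y) = dist x y"
    and p_measurable [measurable]: "p \<in> borel_measurable borel"
    and p_inverse [simp]: "\<And>x. p (\<iota> x) = x"
    and range_measurable [measurable]: "range \<iota> \<in> sets borel"
    and dim: "DIM('a) = 2"
begin

text \<open>Both sides are Borel measures on the real axis, so it suffices to compare them on open intervals,
  where the upper and the lower bound for Hausdorff measure meet.\<close>

lemma lborel_eq_distr: "lborel = distr (restrict_space hausdorff_borel (range \<iota>)) borel p"
proof (rule lborel_eqI)
  have pm: "p \<in> restrict_space hausdorff_borel (range \<iota>) \<rightarrow>\<^sub>M borel"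
    by (rule measurable_restrict_space1) simp
  fix l u :: real assume "\<And>b. b \<in> Basis \<Longrightarrow> l \<bullet> b \<le> u \<bullet> b"
  then have lu: "l \<le> u" by simp
  have im: "p -` box l u \<inter> range \<iota> = \<iota> ` {l<..<u}" by auto
  have "p -` box l u \<in> sets borel"
    using measurable_sets[OF p_measurable, of "box l u"] by simp
  then have "p -` box l u \<inter> range \<iota> \<in> sets borel"
    by (rule sets.Int) (rule range_measurable)
  then have m: "\<iota> ` {l<..<u} \<in> sets borel" unfolding im .
  have "emeasure (distr (restrict_space hausdorff_borel (range \<iota>)) borel p) (box l u)
      = hausdorff_outer 1 (\<iota> ` {l<..<u})"
  proof -
    have "emeasure (restrict_space hausdorff_borel (range \<iota>)) (\<iota> ` {l<..<u})
        = emeasure hausdorff_borel (\<iota> ` {l<..<u})"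
      by (rule emeasure_restrict_space) auto
    then show ?thesis
      using m by (simp add: emeasure_distr[OF pm] space_restrict_space im[simplified]
        emeasure_hausdorff_borel dim)
  qed
  also have "\<dots> = ennreal (u - l)"
  proof (cases "l = u")
    case True
    then show ?thesis
      using hausdorff_outer_outer_measure[of 1, where 'a = 'a]
      by (simp add: outer_measure_space_def positive_def)
  next
    case False
    show ?thesis
    proof (rule antisym)
      show "hausdorff_outer 1 (\<iota> ` {l<..<u}) \<le> ennreal (u - l)"
        using False lu by (intro hausdorff_outer_least hausdorff_delta_segment_le iso) auto
      have "ennreal (u - l) = emeasure lborel {l<..<u}" using lu by simp
      also have "\<dots> \<le> hausdorff_delta 1 1 (\<iota> ` {l<..<u})"
        by (intro lborel_le_hausdorff_delta iso) auto
      also have "\<dots> \<le> hausdorff_outer 1 (\<iota> ` {l<..<u})"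
        by (rule hausdorff_delta_le_outer) simp
      finally show "ennreal (u - l) \<le> hausdorff_outer 1 (\<iota> ` {l<..<u})" .
    qed
  qed
  finally show "emeasure (distr (restrict_space hausdorff_borel (range \<iota>)) borel p) (box l u)
    = ennreal (\<Prod>b\<in>Basis. (u - l) \<bullet> b)" by simp
qed simp

lemma has_bochner_integral_line:
  fixes f :: "'a \<Rightarrow> real"
  assumes [measurable]: "f \<in> borel_measurable borel" "S \<in> sets borel"
    and int: "set_integrable lborel S (\<lambda>x. f (\<iota> x))"
  shows "has_bochner_integral surface_measure (\<lambda>z. indicator (\<iota> ` S) z * f z) (LINT x:S|lborel. f (\<iota> x))"
proof -
  have pm [measurable]: "p \<in> restrict_space hausdorff_borel (range \<iota>) \<rightarrow>\<^sub>M borel"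
    by (rule measurable_restrict_space1) simp
  have [measurable]: "\<iota> \<in> borel \<rightarrow>\<^sub>M borel"
  proof (intro borel_measurable_continuous_onI)
    show "continuous_on UNIV \<iota>" unfolding continuous_on_iff by (metis iso)
  qed
  let ?h = "\<lambda>x. indicator S x * f (\<iota> x)"
  have [measurable]: "?h \<in> borel_measurable borel" by measurable
  have "has_bochner_integral lborel ?h (LINT x:S|lborel. f (\<iota> x))"
    using int by (simp add: set_integrable_def set_lebesgue_integral_def has_bochner_integral_integrable)
  then have "has_bochner_integral (restrict_space hausdorff_borel (range \<iota>)) (\<lambda>z. ?h (p z)) (LINT x:S|lborel. f (\<iota> x))"
    by (subst (asm) lborel_eq_distr)
      (simp add: has_bochner_integral_iff integrable_distr_eq integral_distr)
  then have *: "has_bochner_integral hausdorff_borel (\<lambda>z. indicator (range \<iota>) z *\<^sub>R ?h (p z)) (LINT x:S|lborel. f (\<iota> x))"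
    by (simp add: has_bochner_integral_iff integrable_restrict_space integral_restrict_space)
  have "(\<lambda>z. indicator (range \<iota>) z *\<^sub>R ?h (p z)) = (\<lambda>z. indicator (\<iota> ` S) z * f z)"
    by (auto simp: fun_eq_iff indicator_def split: if_splits)
  with * have "has_bochner_integral hausdorff_borel (\<lambda>z. indicator (\<iota> ` S) z * f z) (LINT x:S|lborel. f (\<iota> x))"
    by simp
  then show ?thesis
    unfolding surface_measure_def hausdorff_borel_def[symmetric]
    by (auto simp: has_bochner_integral_iff integrable_completion integral_completion
        dest: borel_measurable_integrable)
qed

end

lemma isometric_line_vertical: "isometric_line (\<lambda>y. (c, y)) (snd :: real \<times> real \<Rightarrow> real)"
proof
  have "range (\<lambda>y. (c, y)) = {c} \<times> (UNIV :: real set)" by auto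
  then show "range (\<lambda>y. (c, y)) \<in> sets (borel :: (real \<times> real) measure)"
    by (simp add: borel_closed closed_Times)
qed (auto simp: dist_Pair_Pair intro!: borel_measurable_continuous_onI continuous_intros)

lemma isometric_line_horizontal: "isometric_line (\<lambda>x. (x, c)) (fst :: real \<times> real \<Rightarrow> real)"
proof
  have "range (\<lambda>x. (x, c)) = (UNIV :: real set) \<times> {c}" by auto
  then show "range (\<lambda>x. (x, c)) \<in> sets (borel :: (real \<times> real) measure)"
    by (simp add: borel_closed closed_Times)
qed (auto simp: dist_Pair_Pair intro!: borel_measurable_continuous_onI continuous_intros)

text \<open>The integral over the boundary of \<open>[-a,a] \<times> [-b,b]\<close>, side by side.\<close>

definition boundary_integral :: "real \<Rightarrow> real \<Rightarrow> (real \<Rightarrow> real \<Rightarrow> real) \<Rightarrow> real" where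
  "boundary_integral a b f =
     integral {-b..b} (f a) + integral {-b..b} (f (-a)) +
     (integral {-a..a} (\<lambda>x. f x b) + integral {-a..a} (\<lambda>x. f x (-b)))"

lemma frontier_rectangle:
  fixes a b :: real
  assumes "0 < a" "0 < b"
  shows "frontier ({-a<..<a} \<times> {-b<..<b}) =
    ((\<lambda>y. (a, y)) ` {-b..b} \<union> (\<lambda>y. (-a, y)) ` {-b..b}) \<union>
    ((\<lambda>x. (x, b)) ` {-a<..<a} \<union> (\<lambda>x. (x, -b)) ` {-a<..<a})"
proof -
  have "interior ({-a<..<a} \<times> {-b<..<b}) = {-a<..<a} \<times> {-b<..<b}"
    by (intro interior_open open_Times) auto
  moreover have "closure ({-a<..<a} \<times> {-b<..<b}) = {-a..a} \<times> {-b..b}"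
    using assms by (simp add: closure_Times)
  ultimately show ?thesis
    unfolding frontier_def using assms by (auto simp: image_iff)
qed

text \<open>The horizontal sides are taken without their end points, so that the four pieces of the boundary
  are disjoint and their indicators add up.\<close>

lemma has_bochner_integral_frontier_rectangle:
  fixes f :: "real \<times> real \<Rightarrow> real"
  assumes ab: "0 < a" "0 < b" and f: "continuous_on UNIV f"
  shows "has_bochner_integral surface_measure
    (\<lambda>z. indicator (frontier ({-a<..<a} \<times> {-b<..<b})) z * f z) (boundary_integral a b (\<lambda>x y. f (x, y)))"
proof -
  have fm: "f \<in> borel_measurable borel" using f by (rule borel_measurable_continuous_onI)
  have c: "continuous_on S (\<lambda>y. f (c, y))" "continuous_on S (\<lambda>x. f (x, c))" for S c
    by (auto intro!: continuous_on_compose2[OF f] continuous_intros)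
  have V: "has_bochner_integral surface_measure (\<lambda>z. indicator ((\<lambda>y. (c, y)) ` {-b..b}) z * f z)
      (integral {-b..b} (\<lambda>y. f (c, y)))" for c
  proof -
    have i: "set_integrable lborel {-b..b} (\<lambda>y. f (c, y))"
      by (intro borel_integrable_atLeastAtMost' c)
    show ?thesis
      using isometric_line.has_bochner_integral_line[OF isometric_line_vertical fm _ i]
      by (simp add: set_borel_integral_eq_integral(2)[OF i])
  qed
  have H: "has_bochner_integral surface_measure (\<lambda>z. indicator ((\<lambda>x. (x, c)) ` {-a<..<a}) z * f z)
      (integral {-a..a} (\<lambda>x. f (x, c)))" for c
  proof -
    have i: "set_integrable lborel {-a<..<a} (\<lambda>x. f (x, c))"
      by (rule set_integrable_subset[of _ "{-a..a}"]) (auto intro!: borel_integrable_atLeastAtMost' c)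
    show ?thesis
      using isometric_line.has_bochner_integral_line[OF isometric_line_horizontal fm _ i]
      by (simp add: set_borel_integral_eq_integral(2)[OF i] integral_open_interval_real)
  qed
  have "indicator (frontier ({-a<..<a} \<times> {-b<..<b})) z * f z =
      (indicator ((\<lambda>y. (a, y)) ` {-b..b}) z * f z + indicator ((\<lambda>y. (-a, y)) ` {-b..b}) z * f z) +
      (indicator ((\<lambda>x. (x, b)) ` {-a<..<a}) z * f z + indicator ((\<lambda>x. (x, -b)) ` {-a<..<a}) z * f z)" for z
    using ab unfolding frontier_rectangle[OF ab]
    by (cases z) (auto simp: indicator_def image_iff)
  then show ?thesis
    unfolding boundary_integral_def
    by (simp only:) (intro has_bochner_integral_add V H)
qed

section \<open>Weighted inequalities on an interval\<close>

text \<open>Since \<open>g' = k - g\<^sup>2\<close>, the derivative of \<open>f\<^sup>2 g\<close> is \<open>f'\<^sup>2 + k f\<^sup>2 - (f' - f g)\<^sup>2\<close>. Equality holds where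
  \<open>f' = f g\<close>, so \<open>g\<close> has to be the logarithmic derivative of the expected extremal function.\<close>

lemma Riccati_inequality:
  fixes f f' g :: "real \<Rightarrow> real"
  assumes ab: "a \<le> b"
    and f: "\<And>x. (f has_real_derivative f' x) (at x)" and f': "continuous_on UNIV f'"
    and g: "\<And>x. x \<in> {a..b} \<Longrightarrow> (g has_real_derivative k - (g x)\<^sup>2) (at x within {a..b})"
  shows "(f b)\<^sup>2 * g b - (f a)\<^sup>2 * g a \<le> integral {a..b} (\<lambda>x. (f' x)\<^sup>2) + k * integral {a..b} (\<lambda>x. (f x)\<^sup>2)"
proof -
  have fc: "continuous_on S f" for S
    using f by (meson DERIV_continuous_on has_field_derivative_at_within)
  have "continuous_on {a..b} g"
    using g by (rule DERIV_continuous_on)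
  note cont = this fc continuous_on_subset[OF f' subset_UNIV]
  let ?G = "\<lambda>x. 2 * f x * f' x * g x + (f x)\<^sup>2 * (k - (g x)\<^sup>2)"
  have "(?G has_integral ((f b)\<^sup>2 * g b - (f a)\<^sup>2 * g a)) {a..b}"
  proof (rule fundamental_theorem_of_calculus[OF ab])
    fix x assume x: "x \<in> {a..b}"
    have "((\<lambda>x. (f x)\<^sup>2 * g x) has_real_derivative ?G x) (at x within {a..b})"
      by (rule derivative_eq_intros has_field_derivative_at_within[OF f] g[OF x] refl)+
         (simp add: power2_eq_square algebra_simps)
    then show "((\<lambda>x. (f x)\<^sup>2 * g x) has_vector_derivative ?G x) (at x within {a..b})"
      by (simp add: has_real_derivative_iff_has_vector_derivative)
  qed
  then have "(f b)\<^sup>2 * g b - (f a)\<^sup>2 * g a = integral {a..b} ?G" by (simp add: integral_unique)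
  also have "\<dots> \<le> integral {a..b} (\<lambda>x. (f' x)\<^sup>2 + k * (f x)\<^sup>2)"
  proof (rule integral_le)
    show "?G integrable_on {a..b}" "(\<lambda>x. (f' x)\<^sup>2 + k * (f x)\<^sup>2) integrable_on {a..b}"
      by (auto intro!: integrable_continuous_real continuous_intros cont)
    fix x
    have "0 \<le> (f' x - f x * g x)\<^sup>2" by simp
    then show "?G x \<le> (f' x)\<^sup>2 + k * (f x)\<^sup>2"
      by (simp add: power2_eq_square algebra_simps)
  qed
  also have "\<dots> = integral {a..b} (\<lambda>x. (f' x)\<^sup>2) + k * integral {a..b} (\<lambda>x. (f x)\<^sup>2)"
    by (subst integral_add) (auto intro!: integrable_continuous_real continuous_intros cont)
  finally show ?thesis .
qed

text \<open>The solution \<open>g = \<beta> tanh (\<beta> x)\<close> vanishes at \<open>0\<close>, so no boundary term arises there.\<close>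

lemma tanh_inequality:
  fixes f f' :: "real \<Rightarrow> real"
  assumes l: "0 \<le> l"
    and f: "\<And>x. (f has_real_derivative f' x) (at x)" and f': "continuous_on UNIV f'"
  shows "\<beta> * tanh (\<beta> * l) * (f l)\<^sup>2 \<le> integral {0..l} (\<lambda>x. (f' x)\<^sup>2) + \<beta>\<^sup>2 * integral {0..l} (\<lambda>x. (f x)\<^sup>2)"
proof -
  have "((\<lambda>x. \<beta> * tanh (\<beta> * x)) has_real_derivative \<beta>\<^sup>2 - (\<beta> * tanh (\<beta> * x))\<^sup>2) (at x within {0..l})" for x
    by (auto intro!: derivative_eq_intros simp: power2_eq_square algebra_simps)
  from Riccati_inequality[OF l f f' this]
  show ?thesis by (simp add: mult.commute)
qed

text \<open>The relevant solution \<open>\<beta> cot (\<beta> (x - m))\<close> is singular at \<open>m\<close>, where \<open>f\<close> vanishes. Shifting its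
  phase by \<open>\<epsilon> > 0\<close> makes it smooth on the interval; the term at \<open>m\<close> is then zero and \<open>\<epsilon>\<close> can tend to
  zero.\<close>

lemma cot_inequality_right:
  fixes f f' :: "real \<Rightarrow> real"
  assumes mb: "m < b" and \<beta>: "0 < \<beta>" "\<beta> * (b - m) < pi / 2"
    and f: "\<And>x. (f has_real_derivative f' x) (at x)" and f': "continuous_on UNIV f'"
    and fm: "f m = 0"
  shows "\<beta> * cot (\<beta> * (b - m)) * (f b)\<^sup>2 + \<beta>\<^sup>2 * integral {m..b} (\<lambda>x. (f x)\<^sup>2)
    \<le> integral {m..b} (\<lambda>x. (f' x)\<^sup>2)"
proof -
  have pos: "0 < \<beta> * (b - m)" using mb \<beta> by simp
  have shifted: "\<beta> * cot (\<beta> * (b - m) + \<epsilon>) * (f b)\<^sup>2 + \<beta>\<^sup>2 * integral {m..b} (\<lambda>x. (f x)\<^sup>2)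
    \<le> integral {m..b} (\<lambda>x. (f' x)\<^sup>2)" if \<epsilon>: "0 < \<epsilon>" "\<epsilon> < pi / 2" for \<epsilon>
  proof -
    have "((\<lambda>x. \<beta> * cot (\<beta> * (x - m) + \<epsilon>)) has_real_derivative
        - \<beta>\<^sup>2 - (\<beta> * cot (\<beta> * (x - m) + \<epsilon>))\<^sup>2) (at x within {m..b})"
      if x: "x \<in> {m..b}" for x
    proof -
      have "\<beta> * (x - m) \<le> \<beta> * (b - m)" "0 \<le> \<beta> * (x - m)" using x \<beta> by auto
      then have "0 < \<beta> * (x - m) + \<epsilon>" "\<beta> * (x - m) + \<epsilon> < pi" using \<epsilon> \<beta> by linarith+
      then have s: "sin (\<beta> * (x - m) + \<epsilon>) \<noteq> 0" using sin_gt_zero by force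
      have eq: "inverse ((sin t)\<^sup>2) = 1 + (cot t)\<^sup>2" if "sin t \<noteq> 0" for t :: real
        using that sin_cos_squared_add[of t] by (simp add: cot_def field_simps)
      have "((\<lambda>x. \<beta> * (x - m) + \<epsilon>) has_real_derivative \<beta>) (at x within {m..b})"
        by (auto intro!: derivative_eq_intros)
      with DERIV_cot[OF s] have "((\<lambda>x. cot (\<beta> * (x - m) + \<epsilon>)) has_real_derivative
          - inverse ((sin (\<beta> * (x - m) + \<epsilon>))\<^sup>2) * \<beta>) (at x within {m..b})"
        by (rule DERIV_chain2)
      from DERIV_cmult[OF this, of \<beta>] have "((\<lambda>x. \<beta> * cot (\<beta> * (x - m) + \<epsilon>)) has_real_derivative
          \<beta> * (- inverse ((sin (\<beta> * (x - m) + \<epsilon>))\<^sup>2) * \<beta>)) (at x within {m..b})" .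
      also have "\<beta> * (- inverse ((sin (\<beta> * (x - m) + \<epsilon>))\<^sup>2) * \<beta>)
          = - \<beta>\<^sup>2 - (\<beta> * cot (\<beta> * (x - m) + \<epsilon>))\<^sup>2"
        unfolding eq[OF s] by (simp add: power2_eq_square algebra_simps)
      finally show ?thesis .
    qed
    from Riccati_inequality[OF less_imp_le[OF mb] f f' this] fm
    show ?thesis by (simp add: algebra_simps)
  qed
  have "sin (\<beta> * (b - m)) \<noteq> 0" using sin_gt_zero pos \<beta> by force
  then have "((\<lambda>\<epsilon>. \<beta> * cot (\<beta> * (b - m) + \<epsilon>) * (f b)\<^sup>2 + \<beta>\<^sup>2 * integral {m..b} (\<lambda>x. (f x)\<^sup>2))
     \<longlongrightarrow> \<beta> * cot (\<beta> * (b - m) + 0) * (f b)\<^sup>2 + \<beta>\<^sup>2 * integral {m..b} (\<lambda>x. (f x)\<^sup>2)) (at_right 0)"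
    by (intro tendsto_intros) simp_all
  moreover have "eventually (\<lambda>\<epsilon>. \<epsilon> \<in> {0<..<pi / 2}) (at_right (0::real))"
    by (rule eventually_at_right_real) simp
  then have "eventually (\<lambda>\<epsilon>. \<beta> * cot (\<beta> * (b - m) + \<epsilon>) * (f b)\<^sup>2 + \<beta>\<^sup>2 * integral {m..b} (\<lambda>x. (f x)\<^sup>2)
    \<le> integral {m..b} (\<lambda>x. (f' x)\<^sup>2)) (at_right 0)"
    by eventually_elim (rule shifted; simp)
  ultimately show ?thesis
    using tendsto_upperbound by fastforce
qed

lemma integral_reflect_midpoint:
  "integral {l/2..l} (\<lambda>x. h (l - x)) = integral {0..l/2} h" for h :: "real \<Rightarrow> real"
proof -
  have "integral {l/2..l} (\<lambda>x. h (l - x)) = integral {-(l/2)..-0} (\<lambda>x. h (- x))"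
    using integral_shift_real_ivl[of "-(l/2)" "-l" 0 "\<lambda>x. h (- x)"] by simp
  also have "\<dots> = integral {0..l/2} h"
    by (rule Henstock_Kurzweil_Integration.integral_reflect_real)
  finally show ?thesis .
qed

text \<open>On each half of the interval the phase condition allows the frequency \<open>2 \<beta>\<close>. This doubling is the
  room that the estimate for even functions lives on. At the left end the boundary term is
  dropped.\<close>

lemma cot_inequality_midpoint:
  fixes f f' :: "real \<Rightarrow> real"
  assumes l: "0 < l" and \<beta>: "0 < \<beta>" "\<beta> * l < pi / 2"
    and f: "\<And>x. (f has_real_derivative f' x) (at x)" and f': "continuous_on UNIV f'"
    and fm: "f (l / 2) = 0"
  shows "2 * \<beta> * cot (\<beta> * l) * (f l)\<^sup>2 + 4 * \<beta>\<^sup>2 * integral {0..l} (\<lambda>x. (f x)\<^sup>2)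
    \<le> integral {0..l} (\<lambda>x. (f' x)\<^sup>2)"
proof -
  have fc: "continuous_on S f" for S
    using f by (meson DERIV_continuous_on has_field_derivative_at_within)
  note cont = fc continuous_on_subset[OF f' subset_UNIV]
  have right: "2 * \<beta> * cot (\<beta> * l) * (f l)\<^sup>2 + 4 * \<beta>\<^sup>2 * integral {l/2..l} (\<lambda>x. (f x)\<^sup>2)
    \<le> integral {l/2..l} (\<lambda>x. (f' x)\<^sup>2)"
    using cot_inequality_right[of "l/2" l "2 * \<beta>" f f'] l \<beta> f f' fm by (simp add: power_mult_distrib)
  let ?h = "\<lambda>x. f (l - x)"
  have "(?h has_real_derivative - f' (l - x)) (at x)" for x
  proof -
    have "((\<lambda>x. l - x) has_real_derivative -1) (at x)" by (auto intro!: derivative_eq_intros)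
    with f have "(?h has_real_derivative f' (l - x) * -1) (at x)" by (rule DERIV_chain2)
    then show ?thesis by simp
  qed
  moreover have "continuous_on UNIV (\<lambda>x. - f' (l - x))"
    by (intro continuous_intros continuous_on_compose2[OF f']) auto
  ultimately have "2 * \<beta> * cot (\<beta> * l) * (f 0)\<^sup>2 + 4 * \<beta>\<^sup>2 * integral {l/2..l} (\<lambda>x. (f (l - x))\<^sup>2)
    \<le> integral {l/2..l} (\<lambda>x. (f' (l - x))\<^sup>2)"
    using cot_inequality_right[of "l/2" l "2 * \<beta>" ?h "\<lambda>x. - f' (l - x)"] l \<beta> fm
    by (simp add: power_mult_distrib)
  moreover note integral_reflect_midpoint[of l "\<lambda>x. (f x)\<^sup>2"] integral_reflect_midpoint[of l "\<lambda>x. (f' x)\<^sup>2"]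
  moreover have "0 \<le> cot (\<beta> * l)"
    using l \<beta> by (intro less_imp_le cot_gt_zero) auto
  ultimately have left: "4 * \<beta>\<^sup>2 * integral {0..l/2} (\<lambda>x. (f x)\<^sup>2) \<le> integral {0..l/2} (\<lambda>x. (f' x)\<^sup>2)"
    using \<beta> by (smt (verit) mult_nonneg_nonneg zero_le_power2)
  have comb: "integral {0..l} h = integral {0..l/2} h + integral {l/2..l} h"
    if "continuous_on UNIV h" for h :: "real \<Rightarrow> real"
    using l by (intro Henstock_Kurzweil_Integration.integral_combine[symmetric] integrable_continuous_real
        continuous_on_subset[OF that]) auto
  show ?thesis
    using left right by (simp add: comb continuous_on_power cont distrib_left)
qed

text \<open>Integration by parts turns the mean value condition into \<open>\<integral> x f'(x) dx = l f(l)\<close>. The bound is then the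
  Cauchy-Schwarz inequality for \<open>x\<close> and \<open>f'\<close>.\<close>

lemma mean_zero_endpoint_bound:
  fixes f f' :: "real \<Rightarrow> real"
  assumes l: "0 < l"
    and f: "\<And>x. (f has_real_derivative f' x) (at x)" and f': "continuous_on UNIV f'"
    and mean: "integral {0..l} f = 0"
  shows "(f l)\<^sup>2 \<le> l / 3 * integral {0..l} (\<lambda>x. (f' x)\<^sup>2)"
proof -
  have fc: "continuous_on S f" for S
    using f by (meson DERIV_continuous_on has_field_derivative_at_within)
  note cont = fc continuous_on_subset[OF f' subset_UNIV]
  have "((\<lambda>x. f x + x * f' x) has_integral (l * f l - 0 * f 0)) {0..l}"
  proof (rule fundamental_theorem_of_calculus)
    fix x
    have "((\<lambda>x. x * f x) has_real_derivative f x + x * f' x) (at x within {0..l})"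
      by (rule derivative_eq_intros has_field_derivative_at_within[OF f] refl)+ simp
    then show "((\<lambda>x. x * f x) has_vector_derivative f x + x * f' x) (at x within {0..l})"
      by (simp add: has_real_derivative_iff_has_vector_derivative)
  qed (use l in simp)
  then have "l * f l = integral {0..l} (\<lambda>x. f x + x * f' x)" by (simp add: integral_unique)
  also have "\<dots> = integral {0..l} (\<lambda>x. x * f' x)"
    using mean by (subst integral_add) (auto intro!: integrable_continuous_real continuous_intros cont)
  finally have xf: "integral {0..l} (\<lambda>x. x * f' x) = l * f l" by simp
  have x2: "integral {0..l} (\<lambda>x. x\<^sup>2) = l ^ 3 / 3"
  proof -
    have "((\<lambda>x. x\<^sup>2) has_integral (l ^ 3 / 3 - 0 ^ 3 / 3)) {0..l}"
    proof (rule fundamental_theorem_of_calculus)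
      show "((\<lambda>x. x ^ 3 / 3) has_vector_derivative x\<^sup>2) (at x within {0..l})" for x
        by (auto intro!: derivative_eq_intros simp flip: has_real_derivative_iff_has_vector_derivative)
    qed (use l in simp)
    then show ?thesis by (simp add: integral_unique)
  qed
  \<comment> \<open>The coefficient of the projection of \<open>f'\<close> onto the function \<open>x\<close>.\<close>
  define k where "k = 3 * f l / l\<^sup>2"
  have "integral {0..l} (\<lambda>x. 2 * k * (x * f' x) - k\<^sup>2 * x\<^sup>2) \<le> integral {0..l} (\<lambda>x. (f' x)\<^sup>2)"
  proof (rule integral_le)
    fix x
    have "0 \<le> (f' x - k * x)\<^sup>2" by simp
    then show "2 * k * (x * f' x) - k\<^sup>2 * x\<^sup>2 \<le> (f' x)\<^sup>2"
      by (simp add: power2_eq_square algebra_simps)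
  qed (auto intro!: integrable_continuous_real continuous_intros cont)
  moreover have "integral {0..l} (\<lambda>x. 2 * k * (x * f' x) - k\<^sup>2 * x\<^sup>2) = 2 * k * (l * f l) - k\<^sup>2 * (l ^ 3 / 3)"
    by (subst integral_diff) (auto intro!: integrable_continuous_real continuous_intros cont simp: xf x2)
  moreover have "2 * k * (l * f l) - k\<^sup>2 * (l ^ 3 / 3) = 3 / l * (f l)\<^sup>2"
    using l by (simp add: k_def field_simps power2_eq_square power3_eq_cube)
  ultimately have "3 / l * (f l)\<^sup>2 \<le> integral {0..l} (\<lambda>x. (f' x)\<^sup>2)" by linarith
  then show ?thesis using l by (simp add: field_simps)
qed

section \<open>Continuously differentiable functions on a quarter rectangle\<close>

text \<open>The functions live on the whole plane. This avoids one-sided derivatives at the boundary of the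
  rectangle and is all that is needed, as traces are limits of functions smooth on the plane.\<close>

definition C1 :: "(real \<Rightarrow> real \<Rightarrow> real) \<Rightarrow> (real \<Rightarrow> real \<Rightarrow> real) \<Rightarrow> (real \<Rightarrow> real \<Rightarrow> real) \<Rightarrow> bool" where
  "C1 f f1 f2 \<longleftrightarrow>
     (\<forall>x y. ((\<lambda>x. f x y) has_real_derivative f1 x y) (at x)) \<and>
     (\<forall>x y. (f x has_real_derivative f2 x y) (at y)) \<and>
     continuous_on UNIV (\<lambda>(x, y). f x y) \<and>
     continuous_on UNIV (\<lambda>(x, y). f1 x y) \<and>
     continuous_on UNIV (\<lambda>(x, y). f2 x y)"

definition rect_integral :: "real \<Rightarrow> real \<Rightarrow> real \<Rightarrow> real \<Rightarrow> (real \<Rightarrow> real \<Rightarrow> real) \<Rightarrow> real" where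
  "rect_integral a b c d f = integral {a..b} (\<lambda>x. integral {c..d} (f x))"

abbreviation cont2 :: "(real \<Rightarrow> real \<Rightarrow> real) \<Rightarrow> bool" where
  "cont2 f \<equiv> continuous_on UNIV (\<lambda>(x, y). f x y)"

lemma cont2_compose:
  assumes "cont2 f" "continuous_on S g" "continuous_on S h"
  shows "continuous_on S (\<lambda>z. f (g z) (h z))"
  using continuous_on_compose2[OF assms(1) continuous_on_Pair[OF assms(2,3)]] by simp

lemma cont2_slices:
  assumes "cont2 f"
  shows "continuous_on S (f x)" "continuous_on S (\<lambda>x. f x y)"
  by (intro cont2_compose[OF assms] continuous_intros)+

lemma cont2_swap: "cont2 f \<Longrightarrow> cont2 (\<lambda>y x. f x y)"
  unfolding case_prod_unfold by (rule cont2_compose) (auto intro!: continuous_intros simp: case_prod_unfold)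

lemma continuous_on_slice_integral:
  assumes "cont2 f"
  shows "continuous_on S (\<lambda>x. integral {c..d} (f x))"
proof -
  have "continuous_on (S \<times> cbox c d) (\<lambda>(x, y). f x y)"
    using assms continuous_on_subset by blast
  then show ?thesis using integral_continuous_on_param[of S c d f] by simp
qed

lemma cont2_binary:
  assumes "cont2 f" "cont2 g"
  shows "cont2 (\<lambda>x y. f x y + g x y)" "cont2 (\<lambda>x y. f x y - g x y)" "cont2 (\<lambda>x y. f x y * g x y)"
  using assms by (auto simp: case_prod_unfold intro!: continuous_intros)

lemma cont2_power2: "cont2 f \<Longrightarrow> cont2 (\<lambda>x y. (f x y)\<^sup>2)"
  by (auto simp: case_prod_unfold intro!: continuous_intros)

lemma cont2_cmult: "cont2 f \<Longrightarrow> cont2 (\<lambda>x y. c * f x y)"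
  by (auto simp: case_prod_unfold intro!: continuous_intros)

lemma cont2_scale: "cont2 f \<Longrightarrow> cont2 (\<lambda>x y. f (s * x) (t * y))"
  unfolding case_prod_unfold
  by (rule cont2_compose) (auto simp: case_prod_unfold intro!: continuous_intros)

lemma cont2_fst: "continuous_on UNIV g \<Longrightarrow> cont2 (\<lambda>x y. g x)"
  by (auto simp: case_prod_unfold intro!: continuous_on_compose2[of UNIV g] continuous_intros)

lemma integrable_slices:
  assumes "cont2 f"
  shows "f x integrable_on {a..b}" "(\<lambda>x. f x y) integrable_on {a..b}"
    "(\<lambda>x. integral {c..d} (f x)) integrable_on {a..b}"
    "(\<lambda>y. integral {c..d} (\<lambda>x. f x y)) integrable_on {a..b}"
  by (intro integrable_continuous_real cont2_slices continuous_on_slice_integral assms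
      cont2_swap[OF assms])+

lemma rect_integral_swap:
  assumes "cont2 f"
  shows "rect_integral a b c d f = integral {c..d} (\<lambda>y. integral {a..b} (\<lambda>x. f x y))"
proof -
  have "continuous_on (cbox (a, c) (b, d)) (\<lambda>(x, y). f x y)"
    using assms continuous_on_subset by blast
  from integral_swap_continuous[OF this] show ?thesis by (simp add: rect_integral_def)
qed

lemma rect_integral_add:
  assumes "cont2 f" "cont2 g"
  shows "rect_integral a b c d (\<lambda>x y. f x y + g x y) = rect_integral a b c d f + rect_integral a b c d g"
  unfolding rect_integral_def
  by (simp add: Henstock_Kurzweil_Integration.integral_add integrable_slices assms)

lemma rect_integral_cmult:
  "rect_integral a b c d (\<lambda>x y. k * f x y) = k * rect_integral a b c d f"
  unfolding rect_integral_def by simp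

text \<open>Inequalities on horizontal segments that contain a boundary term \<open>h\<close> and a multiple of a second
  integral are integrated over the other variable; the next lemma does this for vertical segments.\<close>

lemma rect_integral_mono_x:
  assumes "cont2 f" "cont2 g" "continuous_on {c..d} h" 
    "\<And>y. h y + k * integral {a..b} (\<lambda>x. g x y) \<le> integral {a..b} (\<lambda>x. f x y)"
  shows "integral {c..d} h + k * rect_integral a b c d g \<le> rect_integral a b c d f"
proof -
  have i: "(\<lambda>y. k * integral {a..b} (\<lambda>x. g x y)) integrable_on {c..d}"
    by (intro integrable_continuous_real continuous_on_mult_left continuous_on_slice_integral
        cont2_swap[OF assms(2)])
  have "integral {c..d} h + k * rect_integral a b c d g
     = integral {c..d} (\<lambda>y. h y + k * integral {a..b} (\<lambda>x. g x y))"
    unfolding rect_integral_swap[OF assms(2)]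
    using Henstock_Kurzweil_Integration.integral_add[OF integrable_continuous_real[OF assms(3)] i] by simp
  also have "\<dots> \<le> rect_integral a b c d f"
    unfolding rect_integral_swap[OF assms(1)]
    by (intro integral_le integrable_add integrable_continuous_real[OF assms(3)] i assms(4)
        integrable_slices(4) assms(1))
  finally show ?thesis .
qed

lemma rect_integral_mono_y:
  assumes "cont2 f" "cont2 g" "continuous_on {a..b} h" 
    "\<And>x. h x + k * integral {c..d} (g x) \<le> integral {c..d} (f x)"
  shows "integral {a..b} h + k * rect_integral a b c d g \<le> rect_integral a b c d f"
proof -
  have i: "(\<lambda>x. k * integral {c..d} (g x)) integrable_on {a..b}"
    by (intro integrable_continuous_real continuous_on_mult_left continuous_on_slice_integral assms(2))
  have "integral {a..b} h + k * rect_integral a b c d g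
     = integral {a..b} (\<lambda>x. h x + k * integral {c..d} (g x))"
    unfolding rect_integral_def
    using Henstock_Kurzweil_Integration.integral_add[OF integrable_continuous_real[OF assms(3)] i] by simp
  also have "\<dots> \<le> rect_integral a b c d f"
    unfolding rect_integral_def
    by (intro integral_le integrable_add integrable_continuous_real[OF assms(3)] i assms(4)
        integrable_slices(3) assms(1))
  finally show ?thesis .
qed

text \<open>The bias-variance decomposition, with \<open>m\<close> the mean value of \<open>g\<close>.\<close>

lemma integral_power2_diff:
  fixes g :: "real \<Rightarrow> real"
  assumes "0 \<le> l" "continuous_on {0..l} g" "integral {0..l} g = l * m"
  shows "integral {0..l} (\<lambda>x. (g x - c)\<^sup>2) = l * (m - c)\<^sup>2 + integral {0..l} (\<lambda>x. (g x - m)\<^sup>2)"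
proof -
  have int: "integral {0..l} (\<lambda>x. (g x - d)\<^sup>2) = integral {0..l} (\<lambda>x. (g x)\<^sup>2) - 2 * d * (l * m) + l * d\<^sup>2" for d
  proof -
    have "((\<lambda>x. (g x)\<^sup>2 - 2 * d * g x + d\<^sup>2) has_integral
        integral {0..l} (\<lambda>x. (g x)\<^sup>2) - 2 * d * integral {0..l} g + l * d\<^sup>2) {0..l}"
      using has_integral_const_real[of "d\<^sup>2" 0 l] assms(1)
      by (intro has_integral_add has_integral_diff has_integral_mult_right integrable_integral
          integrable_continuous_real continuous_intros assms(2)) simp
    then show ?thesis
      by (simp add: integral_unique assms(3) power2_diff algebra_simps)
  qed
  show ?thesis unfolding int[of c] int[of m] by (simp add: power2_eq_square algebra_simps)
qed

lemma tanh_real_le_self: "0 \<le> x \<Longrightarrow> tanh x \<le> (x::real)"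
proof (rule ccontr)
  assume x: "0 \<le> x" and "\<not> tanh x \<le> x"
  have "tanh 0 - 0 \<ge> tanh x - x"
  proof (rule DERIV_nonpos_imp_nonincreasing[OF x])
    fix t :: real
    have "((\<lambda>x. tanh x - x) has_real_derivative - (tanh t)\<^sup>2) (at t)"
      by (auto intro!: derivative_eq_intros)
    then show "\<exists>y. ((\<lambda>x. tanh x - x) has_real_derivative y) (at t) \<and> y \<le> 0" by force
  qed
  then show False using \<open>\<not> tanh x \<le> x\<close> by simp
qed

lemma le_tan: 
  fixes x :: real
  assumes "0 < x" "x < pi / 2"
  shows "x \<le> tan x"
proof -
  have "tan 0 - 0 \<le> tan x - x"
  proof (rule DERIV_nonneg_imp_nondecreasing[OF less_imp_le[OF assms(1)]])
    fix t :: real assume t: "0 \<le> t" "t \<le> x"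
    then have cos: "cos t \<noteq> 0" using assms cos_gt_zero_pi[of t] by auto
    have "inverse ((cos t)\<^sup>2) - 1 = (tan t)\<^sup>2"
      using tan_sec[OF cos] by (simp add: power_inverse)
    then have "((\<lambda>x. tan x - x) has_real_derivative (tan t)\<^sup>2) (at t)"
      using DERIV_diff[OF DERIV_tan[OF cos] DERIV_ident] by simp
    then show "\<exists>y. ((\<lambda>x. tan x - x) has_real_derivative y) (at t) \<and> 0 \<le> y" by force
  qed
  then show ?thesis by simp
qed

lemma C1D:
  assumes "C1 f f1 f2"
  shows "((\<lambda>x. f x y) has_real_derivative f1 x y) (at x)" "(f x has_real_derivative f2 x y) (at y)"
    "cont2 f" "cont2 f1" "cont2 f2"
  using assms by (auto simp: C1_def)

text \<open>The quarter rectangle is \<open>[0,a] \<times> [0,b]\<close> with \<open>x\<close> along the longer side, \<open>\<beta>\<close> is the frequency of the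
  extremal function \<open>sin (\<beta> x) cosh (\<beta> y)\<close> and \<open>\<mu>\<close> its Steklov eigenvalue. That the two formulas for
  \<open>\<mu>\<close> agree is the transcendental equation.\<close>

locale critical =
  fixes a b \<beta> \<mu> :: real
  assumes ab: "0 < b" "b \<le> a" and \<beta>: "0 < \<beta>" "\<beta> * a < pi / 2"
    and \<mu>_cot: "\<mu> = \<beta> * cot (\<beta> * a)" and \<mu>_tanh: "\<mu> = \<beta> * tanh (\<beta> * b)"
begin

lemma a_pos: "0 < a" using ab by simp

lemma \<beta>b: "0 < \<beta> * b" "\<beta> * b \<le> \<beta> * a" "\<beta> * b < pi / 2"
proof -
  show "0 < \<beta> * b" "\<beta> * b \<le> \<beta> * a" using ab \<beta> by auto
  then show "\<beta> * b < pi / 2" using \<beta>(2) by linarith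
qed

lemma \<mu>_pos: "0 < \<mu>" using \<beta>b \<beta> by (simp add: \<mu>_tanh)

lemma \<mu>_le_tanh: "\<mu> \<le> \<beta> * tanh (\<beta> * a)"
  using \<beta>b \<beta> by (simp add: \<mu>_tanh)

lemma \<mu>_le_cot: "\<mu> \<le> \<beta> * cot (\<beta> * b)"
proof -
  have "cot (\<beta> * a) \<le> cot (\<beta> * b)"
  proof (cases "\<beta> * a = \<beta> * b")
    case False
    then have "tan (\<beta> * b) < tan (\<beta> * a)" "0 < tan (\<beta> * b)"
      using \<beta>b \<beta> by (auto intro!: tan_monotone tan_gt_zero)
    then show ?thesis
      by (simp add: cot_altdef inverse_le_iff_le)
  qed (simp only:)
  then show ?thesis using \<beta> by (simp add: \<mu>_cot)
qed

lemma \<mu>_le_sq: "\<mu> \<le> \<beta>\<^sup>2 * b"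
proof -
  have "tanh (\<beta> * b) \<le> \<beta> * b"
    by (rule tanh_real_le_self) (use \<beta>b in simp)
  then show ?thesis using \<beta> by (simp add: \<mu>_tanh power2_eq_square mult.assoc)
qed

lemma \<mu>a_le_1: "\<mu> * a \<le> 1"
proof -
  have p: "0 < \<beta> * a" using \<beta> a_pos by simp
  have "\<beta> * a \<le> tan (\<beta> * a)"
    by (rule le_tan) (use p \<beta> in simp_all)
  moreover have "0 < tan (\<beta> * a)" using \<beta> p by (intro tan_gt_zero)
  ultimately have "(\<beta> * a) * cot (\<beta> * a) \<le> 1" by (simp add: cot_altdef field_simps)
  then show ?thesis by (simp add: \<mu>_cot ac_simps)
qed

text \<open>The case of the extremal function: both one-dimensional inequalities are sharp for it, and their
  terms with \<open>\<beta>\<^sup>2\<close> cancel because it is harmonic.\<close>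

lemma odd_x_inequality:
  assumes f: "C1 f f1 f2" and zero: "\<And>y. f 0 y = 0"
  shows "\<mu> * (integral {0..b} (\<lambda>y. (f a y)\<^sup>2) + integral {0..a} (\<lambda>x. (f x b)\<^sup>2))
    \<le> rect_integral 0 a 0 b (\<lambda>x y. (f1 x y)\<^sup>2) + rect_integral 0 a 0 b (\<lambda>x y. (f2 x y)\<^sup>2)"
proof -
  note f = C1D[OF f]
  have x: "integral {0..b} (\<lambda>y. \<mu> * (f a y)\<^sup>2) + \<beta>\<^sup>2 * rect_integral 0 a 0 b (\<lambda>x y. (f x y)\<^sup>2)
     \<le> rect_integral 0 a 0 b (\<lambda>x y. (f1 x y)\<^sup>2)"
  proof (rule rect_integral_mono_x)
    fix y
    show "\<mu> * (f a y)\<^sup>2 + \<beta>\<^sup>2 * integral {0..a} (\<lambda>x. (f x y)\<^sup>2) \<le> integral {0..a} (\<lambda>x. (f1 x y)\<^sup>2)"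
      using cot_inequality_right[OF a_pos \<beta>(1) _ f(1)[of y] cont2_slices(2)[OF f(4)] zero] \<beta>(2)
      by (simp add: \<mu>_cot)
  qed (intro cont2_power2 f continuous_on_mult_left continuous_on_power cont2_slices)+
  have y: "integral {0..a} (\<lambda>x. \<mu> * (f x b)\<^sup>2) + (- \<beta>\<^sup>2) * rect_integral 0 a 0 b (\<lambda>x y. (f x y)\<^sup>2)
     \<le> rect_integral 0 a 0 b (\<lambda>x y. (f2 x y)\<^sup>2)"
  proof (rule rect_integral_mono_y)
    fix x
    show "\<mu> * (f x b)\<^sup>2 + (- \<beta>\<^sup>2) * integral {0..b} (\<lambda>y. (f x y)\<^sup>2) \<le> integral {0..b} (\<lambda>y. (f2 x y)\<^sup>2)"
      using tanh_inequality[OF less_imp_le[OF ab(1)] f(2)[of x] cont2_slices(1)[OF f(5)], of \<beta>]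
      by (simp add: \<mu>_tanh)
  qed (intro cont2_power2 f continuous_on_mult_left continuous_on_power cont2_slices)+
  from x y show ?thesis by (simp add: distrib_left)
qed

text \<open>The roles of the two directions are exchanged. The same \<open>\<beta>\<close> works since
  \<open>\<mu> \<le> \<beta> tanh (\<beta> a)\<close> and \<open>\<mu> \<le> \<beta> cot (\<beta> b)\<close> for \<open>b \<le> a\<close>.\<close>

lemma odd_y_inequality:
  assumes f: "C1 f f1 f2" and zero: "\<And>x. f x 0 = 0"
  shows "\<mu> * (integral {0..b} (\<lambda>y. (f a y)\<^sup>2) + integral {0..a} (\<lambda>x. (f x b)\<^sup>2))
    \<le> rect_integral 0 a 0 b (\<lambda>x y. (f1 x y)\<^sup>2) + rect_integral 0 a 0 b (\<lambda>x y. (f2 x y)\<^sup>2)"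
proof -
  note f = C1D[OF f]
  have x: "integral {0..b} (\<lambda>y. \<mu> * (f a y)\<^sup>2) + (- \<beta>\<^sup>2) * rect_integral 0 a 0 b (\<lambda>x y. (f x y)\<^sup>2)
     \<le> rect_integral 0 a 0 b (\<lambda>x y. (f1 x y)\<^sup>2)"
  proof (rule rect_integral_mono_x)
    fix y
    show "\<mu> * (f a y)\<^sup>2 + (- \<beta>\<^sup>2) * integral {0..a} (\<lambda>x. (f x y)\<^sup>2) \<le> integral {0..a} (\<lambda>x. (f1 x y)\<^sup>2)"
      using tanh_inequality[OF less_imp_le[OF a_pos] f(1)[of y] cont2_slices(2)[OF f(4)], of \<beta>]
        mult_right_mono[OF \<mu>_le_tanh, of "(f a y)\<^sup>2"] by simp
  qed (intro cont2_power2 f continuous_on_mult_left continuous_on_power cont2_slices)+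
  have y: "integral {0..a} (\<lambda>x. \<mu> * (f x b)\<^sup>2) + \<beta>\<^sup>2 * rect_integral 0 a 0 b (\<lambda>x y. (f x y)\<^sup>2)
     \<le> rect_integral 0 a 0 b (\<lambda>x y. (f2 x y)\<^sup>2)"
  proof (rule rect_integral_mono_y)
    fix x
    show "\<mu> * (f x b)\<^sup>2 + \<beta>\<^sup>2 * integral {0..b} (\<lambda>y. (f x y)\<^sup>2) \<le> integral {0..b} (\<lambda>y. (f2 x y)\<^sup>2)"
      using cot_inequality_right[OF ab(1) \<beta>(1) _ f(2)[of x] cont2_slices(1)[OF f(5)] zero] \<beta>b(3)
        mult_right_mono[OF \<mu>_le_cot, of "(f x b)\<^sup>2"] by simp
  qed (intro cont2_power2 f continuous_on_mult_left continuous_on_power cont2_slices)+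
  from x y show ?thesis by (simp add: distrib_left)
qed

text \<open>Let \<open>U x\<close> be the average of \<open>f x\<close> over \<open>y\<close> and \<open>r = f - U\<close>, whose averages over \<open>y\<close> vanish. Because
  of the mean value condition, replacing \<open>f\<close> by \<open>f - c\<close> with any constant \<open>c\<close> only increases the left-hand
  side; \<open>c = U (a / 2)\<close> is chosen so that the midpoint inequality applies to \<open>U - c\<close>.
  On the side \<open>x = a\<close> the average and the remainder are orthogonal. On the side \<open>y = b\<close> they are not, and
  \<open>(s + t)\<^sup>2 \<le> 2 s\<^sup>2 + 2 t\<^sup>2\<close> is used. The part with \<open>U\<close> is bounded by \<open>b \<integral> U'\<^sup>2\<close>, and the remainder by
  \<open>\<integral>\<integral> r\<^sub>x\<^sup>2\<close> and \<open>1/4 + 2/3 < 1\<close> times \<open>\<integral>\<integral> f\<^sub>y\<^sup>2\<close>.\<close>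

lemma even_inequality:
  assumes f: "C1 f f1 f2" and mean: "integral {0..b} (f a) + integral {0..a} (\<lambda>x. f x b) = 0"
  shows "\<mu> * (integral {0..b} (\<lambda>y. (f a y)\<^sup>2) + integral {0..a} (\<lambda>x. (f x b)\<^sup>2))
    \<le> rect_integral 0 a 0 b (\<lambda>x y. (f1 x y)\<^sup>2) + rect_integral 0 a 0 b (\<lambda>x y. (f2 x y)\<^sup>2)"
proof -
  note f = C1D[OF f]
  define U where "U x = integral {0..b} (f x) / b" for x
  define U' where "U' x = integral {0..b} (f1 x) / b" for x
  define r where "r x y = f x y - U x" for x y
  define r1 where "r1 x y = f1 x y - U' x" for x y
  define c where "c = U (a / 2)"
  have U: "(U has_real_derivative U' x) (at x)" for x
  proof -
    have "((\<lambda>x. integral (cbox 0 b) (f x)) has_field_derivative integral (cbox 0 b) (f1 x)) (at x within UNIV)"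
    proof (rule leibniz_rule_field_derivative)
      show "((\<lambda>x. f x t) has_field_derivative f1 x t) (at x within UNIV)" for x t
        using f(1) by simp
      show "f x integrable_on cbox 0 b" for x
        using integrable_slices(1)[OF f(3)] by simp
      show "continuous_on (UNIV \<times> cbox 0 b) (\<lambda>(x, t). f1 x t)"
        using f(4) continuous_on_subset by blast
    qed auto
    from DERIV_cdivide[OF this, of b] show ?thesis by (simp add: U_def[abs_def] U'_def)
  qed
  have Uc: "continuous_on S U" for S
    using U by (meson DERIV_continuous_on has_field_derivative_at_within)
  have U'c: "continuous_on S U'" for S
    unfolding U'_def[abs_def] by (intro continuous_on_divide continuous_on_slice_integral f continuous_intros) (use ab in auto)
  have r: "cont2 r" "cont2 r1"
    unfolding r_def[abs_def] r1_def[abs_def] by (intro cont2_binary f cont2_fst Uc U'c)+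
  have rx: "((\<lambda>x. r x y) has_real_derivative r1 x y) (at x)" for x y
    unfolding r_def r1_def by (intro DERIV_diff f U)
  have ry: "(r x has_real_derivative f2 x y) (at y)" for x y
    using DERIV_diff[OF f(2)[of x y] DERIV_const[of "U x"]] by (simp add: r_def[abs_def])
  have meanf: "integral {0..b} (f x) = b * U x" and meanf1: "integral {0..b} (f1 x) = b * U' x" for x
    using ab by (simp_all add: U_def U'_def)
  have meanr: "integral {0..b} (r x) = 0" for x
    unfolding r_def using ab
    by (subst Henstock_Kurzweil_Integration.integral_diff) (auto simp: meanf integrable_slices f)
  let ?I = "rect_integral 0 a 0 b"
  let ?R = "?I (\<lambda>x y. (f2 x y)\<^sup>2)"
  \<comment> \<open>The one-dimensional part; the frequency \<open>2 \<beta>\<close> gives twice what is needed, as \<open>\<mu> \<le> \<beta>\<^sup>2 b\<close>.\<close>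
  have mean_part: "\<mu> * b * (U a - c)\<^sup>2 + 2 * \<mu> * integral {0..a} (\<lambda>x. (U x - c)\<^sup>2)
      \<le> b * integral {0..a} (\<lambda>x. (U' x)\<^sup>2)"
  proof -
    have "((\<lambda>x. U x - c) has_real_derivative U' x) (at x)" for x
      using DERIV_diff[OF U DERIV_const[of c]] by simp
    from cot_inequality_midpoint[OF a_pos \<beta> this U'c]
    have "2 * \<mu> * (U a - c)\<^sup>2 + 4 * \<beta>\<^sup>2 * integral {0..a} (\<lambda>x. (U x - c)\<^sup>2)
        \<le> integral {0..a} (\<lambda>x. (U' x)\<^sup>2)"
      by (simp add: \<mu>_cot c_def)
    from mult_left_mono[OF this, of b]
    have 1: "2 * (\<mu> * b * (U a - c)\<^sup>2) + 4 * (\<beta>\<^sup>2 * b * integral {0..a} (\<lambda>x. (U x - c)\<^sup>2))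
        \<le> b * integral {0..a} (\<lambda>x. (U' x)\<^sup>2)"
      using ab by (simp add: algebra_simps)
    have i: "0 \<le> integral {0..a} (\<lambda>x. (U x - c)\<^sup>2)"
      by (intro Henstock_Kurzweil_Integration.integral_nonneg integrable_continuous_real continuous_intros Uc) auto
    then have "\<mu> * integral {0..a} (\<lambda>x. (U x - c)\<^sup>2) \<le> \<beta>\<^sup>2 * b * integral {0..a} (\<lambda>x. (U x - c)\<^sup>2)"
      by (intro mult_right_mono \<mu>_le_sq)
    moreover have "0 \<le> \<mu> * integral {0..a} (\<lambda>x. (U x - c)\<^sup>2)" "0 \<le> \<mu> * b * (U a - c)\<^sup>2"
      using i \<mu>_pos ab by auto
    ultimately show ?thesis using 1 by simp
  qed
  \<comment> \<open>The remainder on \<open>x = a\<close>; the negative term is absorbed by the Poincare inequality that follows.\<close>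
  have right_side: "integral {0..b} (\<lambda>y. \<mu> * (r a y)\<^sup>2) + (- \<beta>\<^sup>2) * ?I (\<lambda>x y. (r x y)\<^sup>2) \<le> ?I (\<lambda>x y. (r1 x y)\<^sup>2)"
  proof (rule rect_integral_mono_x)
    fix y
    show "\<mu> * (r a y)\<^sup>2 + (- \<beta>\<^sup>2) * integral {0..a} (\<lambda>x. (r x y)\<^sup>2) \<le> integral {0..a} (\<lambda>x. (r1 x y)\<^sup>2)"
      using tanh_inequality[OF less_imp_le[OF a_pos] rx[of y] cont2_slices(2)[OF r(2)], of \<beta>]
        mult_right_mono[OF \<mu>_le_tanh, of "(r a y)\<^sup>2"] by simp
  qed (intro cont2_power2 r continuous_on_mult_left continuous_on_power cont2_slices)+
  \<comment> \<open>The midpoint inequality holds for \<open>r x\<close> minus its value at \<open>b / 2\<close>. Since \<open>r x\<close> has mean zero,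
     subtracting a constant does not decrease the integral of its square.\<close>
  have Poincare: "integral {0..a} (\<lambda>x. 0) + 4 * \<beta>\<^sup>2 * ?I (\<lambda>x y. (r x y)\<^sup>2) \<le> ?R"
  proof (rule rect_integral_mono_y)
    fix x
    define d where "d = r x (b / 2)"
    have "((\<lambda>y. r x y - d) has_real_derivative f2 x y) (at y)" for y
      using DERIV_diff[OF ry DERIV_const[of d]] by simp
    from cot_inequality_midpoint[OF ab(1) \<beta>(1) \<beta>b(3) this cont2_slices(1)[OF f(5)]]
    have "2 * \<beta> * cot (\<beta> * b) * (r x b - d)\<^sup>2 + 4 * \<beta>\<^sup>2 * integral {0..b} (\<lambda>y. (r x y - d)\<^sup>2)
        \<le> integral {0..b} (\<lambda>y. (f2 x y)\<^sup>2)"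
      by (simp add: d_def)
    moreover have "0 \<le> 2 * \<beta> * cot (\<beta> * b) * (r x b - d)\<^sup>2"
      using \<beta>(1) cot_gt_zero[OF \<beta>b(1,3)] by simp
    moreover have "integral {0..b} (\<lambda>y. (r x y - d)\<^sup>2) = b * d\<^sup>2 + integral {0..b} (\<lambda>y. (r x y)\<^sup>2)"
      using integral_power2_diff[of b "r x" 0 d] ab meanr cont2_slices(1)[OF r(1)] by simp
    then have "4 * \<beta>\<^sup>2 * integral {0..b} (\<lambda>y. (r x y)\<^sup>2) \<le> 4 * \<beta>\<^sup>2 * integral {0..b} (\<lambda>y. (r x y - d)\<^sup>2)"
      using ab by (intro mult_left_mono) auto
    ultimately show "0 + 4 * \<beta>\<^sup>2 * integral {0..b} (\<lambda>y. (r x y)\<^sup>2) \<le> integral {0..b} (\<lambda>y. (f2 x y)\<^sup>2)"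
      by linarith
  qed (intro cont2_power2 r f continuous_intros)+
  \<comment> \<open>The remainder on \<open>y = b\<close>, using \<open>\<mu> b \<le> \<mu> a \<le> 1\<close>.\<close>
  have top_side: "integral {0..a} (\<lambda>x. 3 * \<mu> * (r x b)\<^sup>2) + 0 * ?R \<le> ?R"
  proof (rule rect_integral_mono_y)
    fix x
    have "(r x b)\<^sup>2 \<le> b / 3 * integral {0..b} (\<lambda>y. (f2 x y)\<^sup>2)"
      by (rule mean_zero_endpoint_bound[OF ab(1) ry cont2_slices(1)[OF f(5)] meanr])
    from mult_left_mono[OF this, of "3 * \<mu>"]
    have "3 * \<mu> * (r x b)\<^sup>2 \<le> (\<mu> * b) * integral {0..b} (\<lambda>y. (f2 x y)\<^sup>2)"
      using \<mu>_pos by simp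
    also have "\<dots> \<le> 1 * integral {0..b} (\<lambda>y. (f2 x y)\<^sup>2)"
    proof (rule mult_right_mono)
      have "\<mu> * b \<le> \<mu> * a" using \<mu>_pos ab by simp
      then show "\<mu> * b \<le> 1" using \<mu>a_le_1 by linarith
      show "0 \<le> integral {0..b} (\<lambda>y. (f2 x y)\<^sup>2)"
        by (intro Henstock_Kurzweil_Integration.integral_nonneg integrable_slices(1) cont2_power2 f) auto
    qed
    finally show "3 * \<mu> * (r x b)\<^sup>2 + 0 * integral {0..b} (\<lambda>y. (f2 x y)\<^sup>2) \<le> integral {0..b} (\<lambda>y. (f2 x y)\<^sup>2)"
      by simp
  qed (intro cont2_power2 r f continuous_on_mult_left continuous_on_power cont2_slices)+
  \<comment> \<open>The average and the remainder are orthogonal for the \<open>x\<close>-derivatives as well.\<close>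
  have Pythagoras: "b * integral {0..a} (\<lambda>x. (U' x)\<^sup>2) + ?I (\<lambda>x y. (r1 x y)\<^sup>2) = ?I (\<lambda>x y. (f1 x y)\<^sup>2)"
  proof -
    have "integral {0..b} (\<lambda>y. (f1 x y)\<^sup>2) = b * (U' x)\<^sup>2 + integral {0..b} (\<lambda>y. (r1 x y)\<^sup>2)" for x
      using integral_power2_diff[of b "f1 x" "U' x" 0] ab meanf1 cont2_slices(1)[OF f(4)]
      by (simp add: r1_def)
    then have "?I (\<lambda>x y. (f1 x y)\<^sup>2) = integral {0..a} (\<lambda>x. b * (U' x)\<^sup>2 + integral {0..b} (\<lambda>y. (r1 x y)\<^sup>2))"
      by (simp add: rect_integral_def)
    also have "\<dots> = integral {0..a} (\<lambda>x. b * (U' x)\<^sup>2) + ?I (\<lambda>x y. (r1 x y)\<^sup>2)"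
      unfolding rect_integral_def
      by (intro Henstock_Kurzweil_Integration.integral_add integrable_slices(3) cont2_power2 r
          integrable_continuous_real continuous_on_mult_left continuous_on_power U'c)
    finally show ?thesis by simp
  qed
  have fa: "integral {0..b} (\<lambda>y. (f a y - c)\<^sup>2) = b * (U a - c)\<^sup>2 + integral {0..b} (\<lambda>y. (r a y)\<^sup>2)"
    using integral_power2_diff[of b "f a" "U a" c] ab meanf cont2_slices(1)[OF f(3)]
    by (simp add: r_def)
  have fb: "integral {0..a} (\<lambda>x. (f x b - c)\<^sup>2)
      \<le> 2 * integral {0..a} (\<lambda>x. (U x - c)\<^sup>2) + 2 * integral {0..a} (\<lambda>x. (r x b)\<^sup>2)"
  proof -
    have rb: "continuous_on {0..a} (\<lambda>x. r x b)" "continuous_on {0..a} (\<lambda>x. f x b)"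
      by (intro cont2_slices r f)+
    have "integral {0..a} (\<lambda>x. (f x b - c)\<^sup>2) \<le> integral {0..a} (\<lambda>x. 2 * (U x - c)\<^sup>2 + 2 * (r x b)\<^sup>2)"
    proof (rule integral_le)
      fix x
      have "0 \<le> ((U x - c) - r x b)\<^sup>2" by simp
      then show "(f x b - c)\<^sup>2 \<le> 2 * (U x - c)\<^sup>2 + 2 * (r x b)\<^sup>2"
        by (simp add: r_def power2_eq_square algebra_simps)
    qed (intro integrable_continuous_real continuous_intros Uc rb)+
    also have "\<dots> = integral {0..a} (\<lambda>x. 2 * (U x - c)\<^sup>2) + integral {0..a} (\<lambda>x. 2 * (r x b)\<^sup>2)"
      by (intro Henstock_Kurzweil_Integration.integral_add integrable_continuous_real continuous_intros Uc rb)
    finally show ?thesis by simp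
  qed
  have shift: "integral {0..b} (\<lambda>y. (f a y)\<^sup>2) + integral {0..a} (\<lambda>x. (f x b)\<^sup>2)
     \<le> integral {0..b} (\<lambda>y. (f a y - c)\<^sup>2) + integral {0..a} (\<lambda>x. (f x b - c)\<^sup>2)"
  proof -
    define mb where "mb = integral {0..a} (\<lambda>x. f x b) / a"
    have mb: "integral {0..a} (\<lambda>x. f x b) = a * mb" using a_pos by (simp add: mb_def)
    have eq: "b * U a + a * mb = 0" using mean by (simp add: mb meanf)
    note A = integral_power2_diff[OF less_imp_le[OF ab(1)] cont2_slices(1)[OF f(3)] meanf[of a]]
    note B = integral_power2_diff[OF less_imp_le[OF a_pos] cont2_slices(2)[OF f(3)] mb]
    have "integral {0..b} (\<lambda>y. (f a y - c)\<^sup>2) + integral {0..a} (\<lambda>x. (f x b - c)\<^sup>2)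
       - (integral {0..b} (\<lambda>y. (f a y)\<^sup>2) + integral {0..a} (\<lambda>x. (f x b)\<^sup>2))
       = (b * (U a - c)\<^sup>2 + a * (mb - c)\<^sup>2) - (b * (U a)\<^sup>2 + a * mb\<^sup>2)"
      using A[of c] A[of 0] B[of c] B[of 0] by simp
    also have "\<dots> = (a + b) * c\<^sup>2 - 2 * c * (b * U a + a * mb)"
      by (simp add: power2_eq_square algebra_simps)
    also have "\<dots> \<ge> 0" using eq a_pos ab by simp
    finally show ?thesis by simp
  qed
  have "\<mu> * (integral {0..b} (\<lambda>y. (f a y)\<^sup>2) + integral {0..a} (\<lambda>x. (f x b)\<^sup>2))
      \<le> \<mu> * (b * (U a - c)\<^sup>2 + integral {0..b} (\<lambda>y. (r a y)\<^sup>2) +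
        (2 * integral {0..a} (\<lambda>x. (U x - c)\<^sup>2) + 2 * integral {0..a} (\<lambda>x. (r x b)\<^sup>2)))"
    using shift fa fb \<mu>_pos by (intro mult_left_mono) auto
  also have "\<dots> = (\<mu> * b * (U a - c)\<^sup>2 + 2 * \<mu> * integral {0..a} (\<lambda>x. (U x - c)\<^sup>2))
      + integral {0..b} (\<lambda>y. \<mu> * (r a y)\<^sup>2) + 2 / 3 * integral {0..a} (\<lambda>x. 3 * \<mu> * (r x b)\<^sup>2)"
    by (simp add: algebra_simps)
  also have "\<dots> \<le> b * integral {0..a} (\<lambda>x. (U' x)\<^sup>2)
      + (?I (\<lambda>x y. (r1 x y)\<^sup>2) + 1 / 4 * ?R) + 2 / 3 * ?R"
    using mean_part right_side Poincare top_side by (intro add_mono) simp_all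
  also have "\<dots> \<le> ?I (\<lambda>x y. (f1 x y)\<^sup>2) + ?R"
  proof -
    have "0 \<le> ?R"
      unfolding rect_integral_def
      by (intro Henstock_Kurzweil_Integration.integral_nonneg integrable_slices cont2_power2 f ballI) auto
    then show ?thesis using Pythagoras by simp
  qed
  finally show ?thesis .
qed

end

section \<open>Splitting a rectangle by parity\<close>

text \<open>For signs \<open>\<sigma>\<close> and \<open>\<tau>\<close> this is the component of \<open>g\<close> that is multiplied by \<open>\<sigma>\<close> under \<open>x \<mapsto> -x\<close> and by \<open>\<tau>\<close>
  under \<open>y \<mapsto> -y\<close>.\<close>

definition parity_part :: "real \<Rightarrow> real \<Rightarrow> (real \<Rightarrow> real \<Rightarrow> real) \<Rightarrow> real \<Rightarrow> real \<Rightarrow> real" where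
  "parity_part \<sigma> \<tau> g x y = (g x y + \<sigma> * g (-x) y + \<tau> * g x (-y) + \<sigma> * \<tau> * g (-x) (-y)) / 4"

text \<open>Integrals of \<open>g\<close> over the rectangle and its boundary are integrals of \<open>fold4 g\<close> over a quarter.\<close>

definition fold4 :: "(real \<Rightarrow> real \<Rightarrow> real) \<Rightarrow> real \<Rightarrow> real \<Rightarrow> real" where
  "fold4 g x y = (g x y + g (-x) y) + (g x (-y) + g (-x) (-y))"

lemma cont2_reflect:
  assumes "cont2 g"
  shows "cont2 (\<lambda>x y. g (-x) y)" "cont2 (\<lambda>x y. g x (-y))" "cont2 (\<lambda>x y. g (-x) (-y))"
  using cont2_scale[OF assms, of "-1" 1] cont2_scale[OF assms, of 1 "-1"]
    cont2_scale[OF assms, of "-1" "-1"] by simp_all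

lemma cont2_parity_part: "cont2 g \<Longrightarrow> cont2 (parity_part \<sigma> \<tau> g)"
  unfolding parity_part_def[abs_def]
  using cont2_cmult[of "\<lambda>x y. g x y + \<sigma> * g (-x) y + \<tau> * g x (-y) + \<sigma> * \<tau> * g (-x) (-y)" "1 / 4"]
  by (simp add: cont2_binary cont2_cmult cont2_reflect)

text \<open>Orthogonality of the four parities: mixed products cancel after summation over reflections.\<close>

lemma parity_sum_of_squares:
  "(parity_part 1 1 g x y)\<^sup>2 + (parity_part (-1) 1 g x y)\<^sup>2 +
     ((parity_part 1 (-1) g x y)\<^sup>2 + (parity_part (-1) (-1) g x y)\<^sup>2) =
   1 / 4 * fold4 (\<lambda>x y. (g x y)\<^sup>2) x y"
  unfolding parity_part_def fold4_def by (simp add: power2_eq_square field_simps)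

text \<open>Differentiation in a variable reverses the parity in that variable.\<close>

lemma C1_parity_part:
  assumes "C1 f f1 f2"
  shows "C1 (parity_part \<sigma> \<tau> f) (parity_part (-\<sigma>) \<tau> f1) (parity_part \<sigma> (-\<tau>) f2)"
proof -
  note f = C1D[OF assms]
  have x: "((\<lambda>x. f (-x) y) has_real_derivative - f1 (-x) y) (at x)" for x y
  proof -
    have "((\<lambda>x. - x) has_real_derivative -1) (at x)" by (auto intro!: derivative_eq_intros)
    with f(1)[of y "-x"] have "((\<lambda>x. f (-x) y) has_real_derivative f1 (-x) y * -1) (at x)"
      by (rule DERIV_chain2[where f = "\<lambda>x. f x y"])
    then show ?thesis by simp
  qed
  have y: "((\<lambda>y. f x (-y)) has_real_derivative - f2 x (-y)) (at y)" for x y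
  proof -
    have "((\<lambda>x. - x) has_real_derivative -1) (at y)" by (auto intro!: derivative_eq_intros)
    with f(2)[of x "-y"] have "((\<lambda>y. f x (-y)) has_real_derivative f2 x (-y) * -1) (at y)"
      by (rule DERIV_chain2[where f = "f x"])
    then show ?thesis by simp
  qed
  show ?thesis
    unfolding C1_def
  proof (intro conjI allI)
    show "((\<lambda>x. parity_part \<sigma> \<tau> f x y) has_real_derivative parity_part (- \<sigma>) \<tau> f1 x y) (at x)" for x y
      unfolding parity_part_def by (rule derivative_eq_intros f x refl | simp)+
    show "(parity_part \<sigma> \<tau> f x has_real_derivative parity_part \<sigma> (- \<tau>) f2 x y) (at y)" for x y
      unfolding parity_part_def[abs_def] by (rule derivative_eq_intros f y refl | simp)+
  qed (intro cont2_parity_part f)+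
qed

lemma integral_fold:
  fixes g :: "real \<Rightarrow> real"
  assumes "0 \<le> l" "continuous_on UNIV g"
  shows "integral {-l..l} g = integral {0..l} (\<lambda>x. g x + g (-x))"
proof -
  have i: "g integrable_on {u..v}" "(\<lambda>x. g (-x)) integrable_on {u..v}" for u v
    by (intro integrable_continuous_real continuous_on_compose2[OF assms(2)] continuous_intros; simp)+
  have "integral {-l..l} g = integral {-l..0} g + integral {0..l} g"
    by (rule Henstock_Kurzweil_Integration.integral_combine[symmetric]) (use assms i in auto)
  also have "integral {-l..0} g = integral {0..l} (\<lambda>x. g (-x))"
    using Henstock_Kurzweil_Integration.integral_reflect_real[of l 0 "\<lambda>x. g (-x)"] by simp
  finally show ?thesis
    using i by (simp add: Henstock_Kurzweil_Integration.integral_add)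
qed

lemma rect_integral_fold4:
  assumes "0 \<le> a" "0 \<le> b" and g: "cont2 g"
  shows "rect_integral (-a) a (-b) b g = rect_integral 0 a 0 b (fold4 g)"
proof -
  have "integral {-b..b} (g x) = integral {0..b} (\<lambda>y. g x y + g x (-y))" for x
    by (rule integral_fold[OF assms(2) cont2_slices(1)[OF g]])
  then have "rect_integral (-a) a (-b) b g = integral {-a..a} (\<lambda>x. integral {0..b} (\<lambda>y. g x y + g x (-y)))"
    by (simp add: rect_integral_def)
  also have "\<dots> = integral {0..a} (\<lambda>x. integral {0..b} (\<lambda>y. g x y + g x (-y))
      + integral {0..b} (\<lambda>y. g (-x) y + g (-x) (-y)))"
    by (intro integral_fold assms(1) continuous_on_slice_integral cont2_binary cont2_reflect g)
  also have "\<dots> = rect_integral 0 a 0 b (\<lambda>x y. (g x y + g x (-y)) + (g (-x) y + g (-x) (-y)))"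
    unfolding rect_integral_def
    by (intro integral_cong Henstock_Kurzweil_Integration.integral_add[symmetric] integrable_slices(1)[of "\<lambda>x y. g x y + g x (-y)"]
       integrable_slices(1)[of "\<lambda>x y. g (-x) y + g (-x) (-y)"] cont2_binary cont2_reflect g)
  finally show ?thesis by (simp add: fold4_def[abs_def] algebra_simps)
qed

lemma boundary_integral_fold4:
  assumes "0 \<le> a" "0 \<le> b" and g: "cont2 g"
  shows "boundary_integral a b g = integral {0..b} (fold4 g a) + integral {0..a} (\<lambda>x. fold4 g x b)"
proof -
  note r = cont2_reflect[OF g]
  note i = integrable_slices(1)[OF g] integrable_slices(1)[OF r(1)] integrable_slices(1)[OF r(2)] integrable_slices(1)[OF r(3)]
     integrable_slices(2)[OF g] integrable_slices(2)[OF r(1)] integrable_slices(2)[OF r(2)] integrable_slices(2)[OF r(3)]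
  show ?thesis
    unfolding boundary_integral_def integral_fold[OF assms(2) cont2_slices(1)[OF g]]
      integral_fold[OF assms(1) cont2_slices(2)[OF g]] fold4_def
    using i by (simp add: Henstock_Kurzweil_Integration.integral_add integrable_add algebra_simps)
qed

context critical
begin

lemma parity_inequality:
  assumes f: "C1 f f1 f2" and mean: "boundary_integral a b f = 0"
    and st: "\<sigma> = 1 \<or> \<sigma> = -1" "\<tau> = 1 \<or> \<tau> = -1"
  shows "\<mu> * (integral {0..b} (\<lambda>y. (parity_part \<sigma> \<tau> f a y)\<^sup>2) + integral {0..a} (\<lambda>x. (parity_part \<sigma> \<tau> f x b)\<^sup>2))
    \<le> rect_integral 0 a 0 b (\<lambda>x y. (parity_part (-\<sigma>) \<tau> f1 x y)\<^sup>2) +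
      rect_integral 0 a 0 b (\<lambda>x y. (parity_part \<sigma> (-\<tau>) f2 x y)\<^sup>2)"
proof -
  note C = C1_parity_part[OF f, of \<sigma> \<tau>]
  consider "\<sigma> = -1" | "\<tau> = -1" | "\<sigma> = 1" "\<tau> = 1" using st by blast
  then show ?thesis
  proof cases
    case 1
    then show ?thesis by (intro odd_x_inequality[OF C]) (simp add: parity_part_def)
  next
    case 2
    then show ?thesis by (intro odd_y_inequality[OF C]) (simp add: parity_part_def)
  next
    case 3
    have "parity_part 1 1 f = (\<lambda>x y. 1 / 4 * fold4 f x y)"
      by (simp add: fun_eq_iff parity_part_def fold4_def)
    then have "integral {0..b} (parity_part 1 1 f a) + integral {0..a} (\<lambda>x. parity_part 1 1 f x b)
        = 1 / 4 * boundary_integral a b f"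
      using boundary_integral_fold4[of a b f] a_pos ab C1D(3)[OF f] by simp
    then show ?thesis using 3 mean by (intro even_inequality[OF C]) simp
  qed
qed

text \<open>Summation over the four parities. The \<open>x\<close>-derivative runs through the parities in a different
  order than the function, but the sum over all of them is the same.\<close>

lemma rectangle_inequality:
  assumes f: "C1 f f1 f2" and mean: "boundary_integral a b f = 0"
  shows "\<mu> * boundary_integral a b (\<lambda>x y. (f x y)\<^sup>2)
     \<le> rect_integral (-a) a (-b) b (\<lambda>x y. (f1 x y)\<^sup>2 + (f2 x y)\<^sup>2)"
proof -
  note c = C1D(3-5)[OF f]
  have a0: "0 \<le> a" "0 \<le> b" using ab by auto
  have rect: "rect_integral 0 a 0 b (\<lambda>x y. (parity_part 1 1 g x y)\<^sup>2) + rect_integral 0 a 0 b (\<lambda>x y. (parity_part (-1) 1 g x y)\<^sup>2) +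
     (rect_integral 0 a 0 b (\<lambda>x y. (parity_part 1 (-1) g x y)\<^sup>2) + rect_integral 0 a 0 b (\<lambda>x y. (parity_part (-1) (-1) g x y)\<^sup>2))
     = 1 / 4 * rect_integral (-a) a (-b) b (\<lambda>x y. (g x y)\<^sup>2)" if g: "cont2 g" for g
    unfolding rect_integral_fold4[OF a0 cont2_power2[OF g]] rect_integral_cmult[symmetric]
      parity_sum_of_squares[symmetric]
    by (simp add: rect_integral_add cont2_binary cont2_power2 cont2_parity_part g)
  have bdry: "(integral {0..b} (\<lambda>y. (parity_part 1 1 f a y)\<^sup>2) + integral {0..a} (\<lambda>x. (parity_part 1 1 f x b)\<^sup>2)) +
    (integral {0..b} (\<lambda>y. (parity_part (-1) 1 f a y)\<^sup>2) + integral {0..a} (\<lambda>x. (parity_part (-1) 1 f x b)\<^sup>2)) +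
    ((integral {0..b} (\<lambda>y. (parity_part 1 (-1) f a y)\<^sup>2) + integral {0..a} (\<lambda>x. (parity_part 1 (-1) f x b)\<^sup>2)) +
    (integral {0..b} (\<lambda>y. (parity_part (-1) (-1) f a y)\<^sup>2) + integral {0..a} (\<lambda>x. (parity_part (-1) (-1) f x b)\<^sup>2)))
    = 1 / 4 * boundary_integral a b (\<lambda>x y. (f x y)\<^sup>2)" (is "?L = _")
  proof -
    have i: "(\<lambda>y. (parity_part \<sigma> \<tau> f a y)\<^sup>2) integrable_on {0..b}" "(\<lambda>x. (parity_part \<sigma> \<tau> f x b)\<^sup>2) integrable_on {0..a}" for \<sigma> \<tau>
      using integrable_slices(1,2)[OF cont2_power2[OF cont2_parity_part[OF c(1)]]] by auto
    have "1 / 4 * boundary_integral a b (\<lambda>x y. (f x y)\<^sup>2) =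
       integral {0..b} (\<lambda>y. 1 / 4 * fold4 (\<lambda>x y. (f x y)\<^sup>2) a y) +
       integral {0..a} (\<lambda>x. 1 / 4 * fold4 (\<lambda>x y. (f x y)\<^sup>2) x b)"
      by (simp add: boundary_integral_fold4[OF a0 cont2_power2[OF c(1)]])
    also have "\<dots> = ?L"
      unfolding parity_sum_of_squares[symmetric]
      by (simp add: Henstock_Kurzweil_Integration.integral_add integrable_add i)
    finally show ?thesis by simp
  qed
  note P = parity_inequality[OF assms]
  have "\<mu> * ?L \<le> 1 / 4 * rect_integral (-a) a (-b) b (\<lambda>x y. (f1 x y)\<^sup>2) + 1 / 4 * rect_integral (-a) a (-b) b (\<lambda>x y. (f2 x y)\<^sup>2)"
    using P[of 1 1] P[of "-1" 1] P[of 1 "-1"] P[of "-1" "-1"]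
    unfolding rect[OF c(2), symmetric] rect[OF c(3), symmetric] distrib_left by simp
  then show ?thesis
    unfolding bdry by (simp add: rect_integral_add cont2_power2 c)
qed

end

section \<open>Square-integrable functions\<close>

lemma L2_on_add:
  assumes f: "L2_on M A f" and g: "L2_on M A g"
  shows "L2_on M A (\<lambda>x. f x + g x)"
proof -
  have m: "set_borel_measurable M A (\<lambda>x. f x + g x)"
    using f g by (simp add: L2_on_def set_borel_measurable_def scaleR_add_right borel_measurable_add)
  have "set_integrable M A (\<lambda>x. 2 * (norm (f x))\<^sup>2 + 2 * (norm (g x))\<^sup>2)"
    using f g unfolding L2_on_def by (intro set_integral_add set_integrable_mult_right) auto
  then have i: "integrable M (\<lambda>x. indicator A x *\<^sub>R (2 * (norm (f x))\<^sup>2 + 2 * (norm (g x))\<^sup>2))"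
    by (simp add: set_integrable_def)
  have "integrable M (\<lambda>x. indicator A x *\<^sub>R (norm (f x + g x))\<^sup>2)"
  proof (rule Bochner_Integration.integrable_bound[OF i])
    have eq: "(\<lambda>x. indicator A x *\<^sub>R (norm (f x + g x))\<^sup>2) = (\<lambda>x. (norm (indicator A x *\<^sub>R (f x + g x)))\<^sup>2)"
      by (auto simp: fun_eq_iff indicator_def)
    show "(\<lambda>x. indicator A x *\<^sub>R (norm (f x + g x))\<^sup>2) \<in> borel_measurable M"
      unfolding eq using m unfolding set_borel_measurable_def by measurable
    have "(norm (f x + g x))\<^sup>2 \<le> 2 * (norm (f x))\<^sup>2 + 2 * (norm (g x))\<^sup>2" for x
    proof -
      have "(norm (f x + g x))\<^sup>2 \<le> (norm (f x) + norm (g x))\<^sup>2"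
        by (intro power_mono norm_triangle_ineq) simp
      moreover have "0 \<le> (norm (f x) - norm (g x))\<^sup>2" by simp
      ultimately show ?thesis by (simp add: power2_eq_square algebra_simps)
    qed
    then show "AE x in M. norm (indicator A x *\<^sub>R (norm (f x + g x))\<^sup>2)
        \<le> norm (indicator A x *\<^sub>R (2 * (norm (f x))\<^sup>2 + 2 * (norm (g x))\<^sup>2))"
      by (auto simp: indicator_def)
  qed
  then show ?thesis using m by (simp add: L2_on_def set_integrable_def)
qed

lemma L2_on_uminus: "L2_on M A f \<Longrightarrow> L2_on M A (\<lambda>x. - f x)"
  by (simp add: L2_on_def set_borel_measurable_def)

lemma L2_on_diff: "L2_on M A f \<Longrightarrow> L2_on M A g \<Longrightarrow> L2_on M A (\<lambda>x. f x - g x)"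
  using L2_on_add[of M A f "\<lambda>x. - g x"] L2_on_uminus[of M A g] by simp

lemma L2_norm_on_nonneg: "0 \<le> L2_norm_on M A f"
  by (simp add: L2_norm_on_def set_lebesgue_integral_def)

lemma L2_norm_on_power2: "(L2_norm_on M A f)\<^sup>2 = (LINT x:A|M. (norm (f x))\<^sup>2)"
  by (simp add: L2_norm_on_def set_lebesgue_integral_def)

text \<open>The weights \<open>1 + q / p\<close> and \<open>1 + p / q\<close> in Young's inequality give the square of the sum of the norms when
  \<open>p\<close> and \<open>q\<close> are the two norms; adding \<open>e / 2\<close> to each keeps them positive.\<close>

lemma L2_norm_on_triangle:
  assumes f: "L2_on M A f" and g: "L2_on M A g"
  shows "L2_norm_on M A (\<lambda>x. f x + g x) \<le> L2_norm_on M A f + L2_norm_on M A g"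
proof (rule field_le_epsilon)
  fix e :: real assume e: "0 < e"
  define p q where "p = L2_norm_on M A f + e / 2" and "q = L2_norm_on M A g + e / 2"
  have pq: "0 < p" "0 < q" using e L2_norm_on_nonneg[of M A f] L2_norm_on_nonneg[of M A g]
    by (simp_all add: p_def q_def)
  have "(L2_norm_on M A (\<lambda>x. f x + g x))\<^sup>2 \<le> (LINT x:A|M. (1 + q / p) * (norm (f x))\<^sup>2 + (1 + p / q) * (norm (g x))\<^sup>2)"
    unfolding L2_norm_on_power2
  proof (rule set_integral_mono)
    show "set_integrable M A (\<lambda>x. (norm (f x + g x))\<^sup>2)"
      using L2_on_add[OF f g] by (simp add: L2_on_def)
    show "set_integrable M A (\<lambda>x. (1 + q / p) * (norm (f x))\<^sup>2 + (1 + p / q) * (norm (g x))\<^sup>2)"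
      using f g unfolding L2_on_def by (intro set_integral_add set_integrable_mult_right) auto
    fix x
    have "(norm (f x + g x))\<^sup>2 \<le> (norm (f x) + norm (g x))\<^sup>2"
      by (intro power_mono norm_triangle_ineq) simp
    also have "\<dots> \<le> (1 + q / p) * (norm (f x))\<^sup>2 + (1 + p / q) * (norm (g x))\<^sup>2"
    proof -
      have "0 \<le> (q * norm (f x) - p * norm (g x))\<^sup>2 / (p * q)" using pq by simp
      then show ?thesis using pq by (simp add: power2_eq_square field_simps)
    qed
    finally show "(norm (f x + g x))\<^sup>2 \<le> (1 + q / p) * (norm (f x))\<^sup>2 + (1 + p / q) * (norm (g x))\<^sup>2" .
  qed
  also have "\<dots> = (1 + q / p) * (L2_norm_on M A f)\<^sup>2 + (1 + p / q) * (L2_norm_on M A g)\<^sup>2"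
    unfolding L2_norm_on_power2 using f g unfolding L2_on_def
    by (subst set_integral_add(2)) (auto intro!: set_integrable_mult_right)
  also have "\<dots> \<le> (1 + q / p) * p\<^sup>2 + (1 + p / q) * q\<^sup>2"
    using pq e L2_norm_on_nonneg[of M A f] L2_norm_on_nonneg[of M A g]
    by (intro add_mono mult_left_mono power_mono) (simp_all add: p_def q_def)
  also have "\<dots> = (p + q)\<^sup>2" using pq by (simp add: power2_eq_square field_simps)
  finally have "L2_norm_on M A (\<lambda>x. f x + g x) \<le> p + q"
    by (rule power2_le_imp_le) (use pq in simp)
  then show "L2_norm_on M A (\<lambda>x. f x + g x) \<le> L2_norm_on M A f + L2_norm_on M A g + e"
    by (simp add: p_def q_def)
qed

lemma L2_norm_on_minus_commute: "L2_norm_on M A (\<lambda>x. f x - g x) = L2_norm_on M A (\<lambda>x. g x - f x)"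
  by (simp add: L2_norm_on_def norm_minus_commute)

lemma L2_norm_on_diff_le:
  assumes f: "L2_on M A f" and g: "L2_on M A g"
  shows "\<bar>L2_norm_on M A f - L2_norm_on M A g\<bar> \<le> L2_norm_on M A (\<lambda>x. f x - g x)"
  using L2_norm_on_triangle[OF L2_on_diff[OF f g] g] L2_norm_on_triangle[OF L2_on_diff[OF g f] f]
    L2_norm_on_minus_commute[of M A f g] by simp

lemma L2_norm_on_tendsto:
  assumes f: "L2_on M A f" and u: "\<And>n. L2_on M A (u n)"
    and lim: "(\<lambda>n. L2_norm_on M A (\<lambda>x. u n x - f x)) \<longlonglongrightarrow> 0"
  shows "(\<lambda>n. L2_norm_on M A (u n)) \<longlonglongrightarrow> L2_norm_on M A f"
proof -
  have "(\<lambda>n. L2_norm_on M A (u n) - L2_norm_on M A f) \<longlonglongrightarrow> 0"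
    by (rule Lim_null_comparison[OF _ lim]) (use L2_norm_on_diff_le[OF u f] in simp)
  then show ?thesis by (simp add: LIM_zero_iff)
qed

lemma set_integrable_L2_on:
  fixes h :: "'a \<Rightarrow> real"
  assumes h: "L2_on M A h" and one: "set_integrable M A (\<lambda>_. 1 :: real)"
  shows "set_integrable M A h"
proof -
  have "set_integrable M A (\<lambda>x. 1 + (norm (h x))\<^sup>2)"
    using h one unfolding L2_on_def by (intro set_integral_add) auto
  then have i: "integrable M (\<lambda>x. indicator A x *\<^sub>R (1 + (norm (h x))\<^sup>2))"
    by (simp add: set_integrable_def)
  show ?thesis
    unfolding set_integrable_def
  proof (rule Bochner_Integration.integrable_bound[OF i])
    have "\<bar>t\<bar> \<le> 1 + t\<^sup>2" for t :: real
    proof -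
      have "0 \<le> (\<bar>t\<bar> - 1)\<^sup>2 + \<bar>t\<bar>" by simp
      then show ?thesis by (simp add: power2_eq_square algebra_simps)
    qed
    then show "AE x in M. norm (indicator A x *\<^sub>R h x) \<le> norm (indicator A x *\<^sub>R (1 + (norm (h x))\<^sup>2))"
      by (auto simp: indicator_def)
  qed (use h in \<open>simp add: L2_on_def set_borel_measurable_def\<close>)
qed

text \<open>Here \<open>c\<close> is the mean value of \<open>h\<close>. The lemma permits approximations of a function with mean zero to
  be corrected to mean zero without loss.\<close>

lemma L2_norm_on_minus_mean_le:
  fixes h :: "'a \<Rightarrow> real"
  assumes h: "L2_on M A h" and one: "set_integrable M A (\<lambda>_. 1 :: real)"
    and c: "(LINT x:A|M. h x) = c * (LINT x:A|M. 1)"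
  shows "L2_norm_on M A (\<lambda>x. h x - c) \<le> L2_norm_on M A h"
proof -
  note hi = set_integrable_L2_on[OF h one]
  have h2: "set_integrable M A (\<lambda>x. (h x)\<^sup>2)" using h by (simp add: L2_on_def)
  have "(LINT x:A|M. (h x - c)\<^sup>2) = (LINT x:A|M. (h x)\<^sup>2 - 2 * c * h x + c\<^sup>2 * 1)"
    by (simp add: power2_diff algebra_simps)
  also have "\<dots> = (LINT x:A|M. (h x)\<^sup>2) - 2 * c * (LINT x:A|M. h x) + c\<^sup>2 * (LINT x:A|M. 1)"
    by (subst set_integral_add(2) set_integral_diff(2);
        (intro set_integral_diff set_integrable_mult_right hi h2 one)?)+
       (simp only: set_integral_mult_right)
  also have "\<dots> = (LINT x:A|M. (h x)\<^sup>2) - c\<^sup>2 * (LINT x:A|M. 1)"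
    by (simp add: c power2_eq_square)
  also have "\<dots> \<le> (LINT x:A|M. (h x)\<^sup>2)"
    by (simp add: set_lebesgue_integral_def)
  finally show ?thesis by (simp add: L2_norm_on_def)
qed

section \<open>From continuously differentiable functions to the Sobolev space\<close>

text \<open>Derivatives in direction \<open>v\<close> as functions of two variables, to match \<open>C1\<close>.\<close>

definition partial_derivative :: "(real \<times> real \<Rightarrow> real) \<Rightarrow> real \<times> real \<Rightarrow> real \<Rightarrow> real \<Rightarrow> real" where
  "partial_derivative u v x y = frechet_derivative u (at (x, y)) v"

lemma C1_of_smooth:
  assumes "smooth u"
  shows "C1 (\<lambda>x y. u (x, y)) (partial_derivative u (1, 0)) (partial_derivative u (0, 1))"
proof -
  have u: "C_k (Suc 0) u" using assms by (simp only: smooth_def)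
  then have diff: "(u has_derivative frechet_derivative u (at z)) (at z)" for z
    using u unfolding C_k.simps(2) by (cases z) (simp add: frechet_derivative_works)
  have lin: "frechet_derivative u (at z) (t *\<^sub>R v) = t * frechet_derivative u (at z) v" for z v t
    using linear_scale[OF has_derivative_linear[OF diff]] by simp
  have cont: "continuous_on UNIV u"
    using has_derivative_continuous[OF diff] by (simp add: continuous_on_eq_continuous_at)
  show ?thesis
    unfolding C1_def
  proof (intro conjI allI)
    fix x y :: real
    have "((\<lambda>x. u (x, y)) has_derivative (\<lambda>t. frechet_derivative u (at (x, y)) (t, 0))) (at x)"
      by (rule has_derivative_compose[OF _ diff, of "\<lambda>x. (x, y)"]) (auto intro!: derivative_eq_intros)
    moreover have "(\<lambda>t. frechet_derivative u (at (x, y)) (t, 0)) = (*) (partial_derivative u (1, 0) x y)"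
    proof
      fix t show "frechet_derivative u (at (x, y)) (t, 0) = partial_derivative u (1, 0) x y * t"
        using lin[of "(x, y)" t "(1, 0)"] by (simp add: partial_derivative_def)
    qed
    ultimately show "((\<lambda>x. u (x, y)) has_real_derivative partial_derivative u (1, 0) x y) (at x)"
      by (simp add: has_field_derivative_def)
    have "((\<lambda>y. u (x, y)) has_derivative (\<lambda>t. frechet_derivative u (at (x, y)) (0, t))) (at y)"
      by (rule has_derivative_compose[OF _ diff, of "\<lambda>y. (x, y)"]) (auto intro!: derivative_eq_intros)
    moreover have "(\<lambda>t. frechet_derivative u (at (x, y)) (0, t)) = (*) (partial_derivative u (0, 1) x y)"
    proof
      fix t show "frechet_derivative u (at (x, y)) (0, t) = partial_derivative u (0, 1) x y * t"
        using lin[of "(x, y)" t "(0, 1)"] by (simp add: partial_derivative_def)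
    qed
    ultimately show "((\<lambda>y. u (x, y)) has_real_derivative partial_derivative u (0, 1) x y) (at y)"
      by (simp add: has_field_derivative_def)
  next
    show "cont2 (\<lambda>x y. u (x, y))" using cont by simp
    show "cont2 (partial_derivative u (1, 0))" "cont2 (partial_derivative u (0, 1))"
      using u by (simp_all add: partial_derivative_def case_prod_unfold Basis_prod_def)
  qed
qed

lemma gradient_prod:
  "gradient u (x, y) = (partial_derivative u (1, 0) x y, partial_derivative u (0, 1) x y)"
proof -
  have B: "(Basis :: (real \<times> real) set) = {(1, 0), (0, 1)}" by (auto simp: Basis_prod_def)
  show ?thesis unfolding gradient_def B by (simp add: partial_derivative_def)
qed

lemma continuous_on_gradient:
  assumes "smooth u"
  shows "continuous_on UNIV (gradient u :: real \<times> real \<Rightarrow> _)"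
proof -
  have "gradient u = (\<lambda>z. (case z of (x, y) \<Rightarrow> partial_derivative u (1, 0) x y, case z of (x, y) \<Rightarrow> partial_derivative u (0, 1) x y))"
    by (auto simp: fun_eq_iff gradient_prod)
  then show ?thesis
    using C1D(4,5)[OF C1_of_smooth[OF assms]] by (simp add: continuous_on_Pair)
qed

lemma continuous_on_smooth: "smooth u \<Longrightarrow> continuous_on UNIV u"
  unfolding smooth_def by (metis C_k.simps(1))

text \<open>Here \<open>a\<close> and \<open>b\<close> are half-widths in no particular order.\<close>

locale rectangle =
  fixes a b :: real and \<Omega> \<Gamma> :: "(real \<times> real) set"
  assumes a: "0 < a" and b: "0 < b"
    and \<Omega>: "\<Omega> = {-a<..<a} \<times> {-b<..<b}" and \<Gamma>: "\<Gamma> = frontier \<Omega>"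
begin

lemma \<Omega>_box: "\<Omega> = box (-a, -b) (a, b)"
  by (auto simp: \<Omega> box_prod)

lemma set_integrable_\<Omega>:
  fixes h :: "real \<times> real \<Rightarrow> 'b::euclidean_space"
  assumes "continuous_on UNIV h"
  shows "set_integrable lebesgue \<Omega> h"
proof (rule set_integrable_subset)
  show "set_integrable lebesgue (cbox (-a, -b) (a, b)) h"
    by (rule absolutely_integrable_continuous) (use assms continuous_on_subset in blast)
qed (auto simp: \<Omega>_box box_subset_cbox)

lemma integral_\<Omega>:
  assumes "continuous_on UNIV h"
  shows "(LINT z:\<Omega>|lebesgue. h z) = rect_integral (-a) a (-b) b (\<lambda>x y. h (x, y))"
proof -
  have "(LINT z:\<Omega>|lebesgue. h z) = integral \<Omega> h"
    by (rule set_lebesgue_integral_eq_integral(2)[OF set_integrable_\<Omega>[OF assms]])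
  also have "\<dots> = integral (cbox (-a, -b) (a, b)) h"
    unfolding \<Omega>_box by (rule integral_open_interval)
  also have "\<dots> = rect_integral (-a) a (-b) b (\<lambda>x y. h (x, y))"
    unfolding rect_integral_def
    using integral_prod_continuous[of "-a" "-b" a b h] continuous_on_subset[OF assms] by simp
  finally show ?thesis .
qed

lemma L2_on_\<Omega>:
  fixes h :: "real \<times> real \<Rightarrow> 'b::euclidean_space"
  assumes "continuous_on UNIV h"
  shows "L2_on lebesgue \<Omega> h"
proof -
  have "set_integrable lebesgue \<Omega> (\<lambda>x. (norm (h x))\<^sup>2)"
    by (intro set_integrable_\<Omega> continuous_intros assms)
  moreover have "set_borel_measurable lebesgue \<Omega> h"
    using set_integrable_\<Omega>[OF assms] unfolding set_integrable_def set_borel_measurable_def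
    by (rule borel_measurable_integrable)
  ultimately show ?thesis by (simp add: L2_on_def)
qed

lemma surface_integral:
  assumes "continuous_on UNIV h"
  shows "set_integrable surface_measure \<Gamma> h"
    "(LINT z:\<Gamma>|surface_measure. h z) = boundary_integral a b (\<lambda>x y. h (x, y))"
  using has_bochner_integral_frontier_rectangle[OF a b assms]
  by (simp_all add: has_bochner_integral_iff set_integrable_def set_lebesgue_integral_def \<Gamma> \<Omega>)

lemma L2_on_\<Gamma>:
  fixes h :: "real \<times> real \<Rightarrow> real"
  assumes "continuous_on UNIV h"
  shows "L2_on surface_measure \<Gamma> h"
proof -
  have "set_integrable surface_measure \<Gamma> (\<lambda>x. (norm (h x))\<^sup>2)"
    by (intro surface_integral continuous_intros assms)
  moreover have "set_borel_measurable surface_measure \<Gamma> h"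
    using surface_integral(1)[OF assms] unfolding set_integrable_def set_borel_measurable_def
    by (rule borel_measurable_integrable)
  ultimately show ?thesis by (simp add: L2_on_def)
qed

lemma L2_norm_\<Gamma>:
  fixes h :: "real \<times> real \<Rightarrow> real"
  assumes "continuous_on UNIV h"
  shows "(L2_norm_on surface_measure \<Gamma> h)\<^sup>2 = boundary_integral a b (\<lambda>x y. (h (x, y))\<^sup>2)"
  unfolding L2_norm_on_power2 using surface_integral(2)[of "\<lambda>z. (h z)\<^sup>2"] assms
  by (simp add: continuous_intros)

lemma L2_norm_gradient:
  assumes "smooth u"
  shows "(L2_norm_on lebesgue \<Omega> (gradient u))\<^sup>2 =
    rect_integral (-a) a (-b) b (\<lambda>x y. (partial_derivative u (1, 0) x y)\<^sup>2 + (partial_derivative u (0, 1) x y)\<^sup>2)"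
  unfolding L2_norm_on_power2 using integral_\<Omega>[of "\<lambda>z. (norm (gradient u z))\<^sup>2"]
    continuous_on_gradient[OF assms]
  by (simp add: continuous_intros gradient_prod norm_Pair)

lemma measure_\<Gamma>: "(LINT z:\<Gamma>|surface_measure. 1) = 4 * (a + b)" "measure surface_measure \<Gamma> = 4 * (a + b)"
proof -
  show "(LINT z:\<Gamma>|surface_measure. 1) = 4 * (a + b)"
    using surface_integral(2)[of "\<lambda>_. 1"] a b by (simp add: boundary_integral_def)
  then show "measure surface_measure \<Gamma> = 4 * (a + b)"
    by (simp add: set_lebesgue_integral_def surface_measure_def)
qed

text \<open>The trace \<open>\<tau>\<close> is a limit of smooth functions \<open>u n\<close>. Subtracting the boundary means gives \<open>v n\<close>, to which
  the inequality applies; \<open>v n - \<tau>\<close> is \<open>u n - \<tau>\<close> minus its mean value, since \<open>\<tau>\<close> has mean zero. Hence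
  \<open>v n\<close> still tends to \<open>\<tau>\<close>, and both sides of the inequality converge.\<close>

lemma trace_inequality_of_C1:
  assumes \<mu>: "0 < \<mu>"
    and ineq: "\<And>f f1 f2. C1 f f1 f2 \<Longrightarrow> boundary_integral a b f = 0 \<Longrightarrow>
      \<mu> * boundary_integral a b (\<lambda>x y. (f x y)\<^sup>2) \<le> rect_integral (-a) a (-b) b (\<lambda>x y. (f1 x y)\<^sup>2 + (f2 x y)\<^sup>2)"
  shows "trace_inequality \<Omega> \<Gamma> (1 / sqrt \<mu>)"
  unfolding trace_inequality_def
proof (intro allI impI)
  fix w g \<tau>
  assume tr: "has_trace \<Omega> (w, g) \<tau>" and mean: "mean_value surface_measure \<Gamma> \<tau> = 0"
  have \<tau>: "L2_on surface_measure \<Gamma> \<tau>" and g: "L2_on lebesgue \<Omega> g"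
    using tr by (auto simp: has_trace_def H1_def \<Gamma>)
  obtain u :: "nat \<Rightarrow> real \<times> real \<Rightarrow> real" where u: "\<And>n. smooth (u n)"
      "(\<lambda>n. L2_norm_on lebesgue \<Omega> (\<lambda>x. gradient (u n) x - g x)) \<longlonglongrightarrow> 0"
      "(\<lambda>n. L2_norm_on surface_measure \<Gamma> (\<lambda>x. u n x - \<tau> x)) \<longlonglongrightarrow> 0"
    using tr by (auto simp: has_trace_def \<Gamma>)
  note one = surface_integral(1)[of "\<lambda>_. 1", OF continuous_on_const]
  have \<tau>0: "(LINT z:\<Gamma>|surface_measure. \<tau> z) = 0"
    using mean a b by (simp add: mean_value_def measure_\<Gamma>)
  note uc = continuous_on_smooth[OF u(1)]
  define m where "m n = (LINT z:\<Gamma>|surface_measure. u n z) / (4 * (a + b))" for n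
  define v where "v n z = u n z - m n" for n z
  have vc: "continuous_on UNIV (v n)" for n
    unfolding v_def[abs_def] by (intro continuous_intros uc)
  have v_lim: "(\<lambda>n. L2_norm_on surface_measure \<Gamma> (\<lambda>x. v n x - \<tau> x)) \<longlonglongrightarrow> 0"
  proof (rule Lim_null_comparison[OF _ u(3)], rule always_eventually, rule allI)
    fix n
    have "L2_norm_on surface_measure \<Gamma> (\<lambda>x. (u n x - \<tau> x) - m n) \<le> L2_norm_on surface_measure \<Gamma> (\<lambda>x. u n x - \<tau> x)"
    proof (rule L2_norm_on_minus_mean_le[OF L2_on_diff[OF L2_on_\<Gamma>[OF uc] \<tau>] one])
      have "(LINT z:\<Gamma>|surface_measure. u n z - \<tau> z) = (LINT z:\<Gamma>|surface_measure. u n z) - 0"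
        by (simp add: set_integral_diff(2)[OF surface_integral(1)[OF uc] set_integrable_L2_on[OF \<tau> one]] \<tau>0)
      then show "(LINT z:\<Gamma>|surface_measure. u n z - \<tau> z) = m n * (LINT z:\<Gamma>|surface_measure. 1)"
        using a b by (simp add: m_def measure_\<Gamma>)
    qed
    then show "norm (L2_norm_on surface_measure \<Gamma> (\<lambda>x. v n x - \<tau> x)) \<le> L2_norm_on surface_measure \<Gamma> (\<lambda>x. u n x - \<tau> x)"
      by (simp add: v_def L2_norm_on_nonneg algebra_simps)
  qed
  have "L2_norm_on surface_measure \<Gamma> (v n) \<le> 1 / sqrt \<mu> * L2_norm_on lebesgue \<Omega> (gradient (u n))" for n
  proof -
    have C1: "C1 (\<lambda>x y. v n (x, y)) (partial_derivative (u n) (1, 0)) (partial_derivative (u n) (0, 1))"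
      using C1_of_smooth[OF u(1)[of n]] vc[of n]
      unfolding C1_def v_def by (auto intro!: derivative_eq_intros)
    have "boundary_integral a b (\<lambda>x y. v n (x, y)) = (LINT z:\<Gamma>|surface_measure. u n z - m n)"
      using surface_integral(2)[OF vc[of n]] by (simp add: v_def)
    also have "\<dots> = (LINT z:\<Gamma>|surface_measure. u n z) - m n * (LINT z:\<Gamma>|surface_measure. 1)"
      using set_integral_diff(2)[OF surface_integral(1)[OF uc] set_integrable_mult_right[OF one, of "m n"]]
      unfolding set_integral_mult_right by simp
    also have "\<dots> = 0" using a b by (simp add: m_def measure_\<Gamma>)
    finally have "\<mu> * (L2_norm_on surface_measure \<Gamma> (v n))\<^sup>2 \<le> (L2_norm_on lebesgue \<Omega> (gradient (u n)))\<^sup>2"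
      unfolding L2_norm_\<Gamma>[OF vc] L2_norm_gradient[OF u(1)] by (rule ineq[OF C1])
    then have "(sqrt \<mu> * L2_norm_on surface_measure \<Gamma> (v n))\<^sup>2 \<le> (L2_norm_on lebesgue \<Omega> (gradient (u n)))\<^sup>2"
      using \<mu> by (simp add: power_mult_distrib)
    then have "sqrt \<mu> * L2_norm_on surface_measure \<Gamma> (v n) \<le> L2_norm_on lebesgue \<Omega> (gradient (u n))"
      by (rule power2_le_imp_le) (rule L2_norm_on_nonneg)
    then show ?thesis using \<mu> by (simp add: field_simps)
  qed
  moreover have "(\<lambda>n. L2_norm_on surface_measure \<Gamma> (v n)) \<longlonglongrightarrow> L2_norm_on surface_measure \<Gamma> \<tau>"
    by (rule L2_norm_on_tendsto[OF \<tau> L2_on_\<Gamma>[OF vc] v_lim])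
  moreover have "(\<lambda>n. 1 / sqrt \<mu> * L2_norm_on lebesgue \<Omega> (gradient (u n))) \<longlonglongrightarrow> 1 / sqrt \<mu> * L2_norm_on lebesgue \<Omega> g"
    by (intro tendsto_mult tendsto_const L2_norm_on_tendsto g u L2_on_\<Omega> continuous_on_gradient)
  ultimately show "L2_norm_on surface_measure \<Gamma> \<tau> \<le> 1 / sqrt \<mu> * L2_norm_on lebesgue \<Omega> g"
    by (intro LIMSEQ_le) auto
qed

end

section \<open>Test functions, Green identity and sharpness\<close>

lemma C1_integral_partials_zero:
  assumes f: "C1 f f1 f2" and a: "0 < a" and b: "0 < b"
    and zero: "\<And>y. f a y = 0" "\<And>y. f (-a) y = 0" "\<And>x. f x b = 0" "\<And>x. f x (-b) = 0"
  shows "rect_integral (-a) a (-b) b f1 = 0" "rect_integral (-a) a (-b) b f2 = 0"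
proof -
  note f = C1D[OF f]
  have "integral {-a..a} (\<lambda>x. f1 x y) = 0" for y
  proof -
    have "((\<lambda>x. f1 x y) has_integral f a y - f (-a) y) {-a..a}"
      by (rule fundamental_theorem_of_calculus)
        (use a f(1) in \<open>auto simp flip: has_real_derivative_iff_has_vector_derivative
            intro: has_field_derivative_at_within\<close>)
    then show ?thesis by (simp add: zero integral_unique)
  qed
  then show "rect_integral (-a) a (-b) b f1 = 0" by (simp add: rect_integral_swap[OF f(4)])
  have "integral {-b..b} (f2 x) = 0" for x
  proof -
    have "(f2 x has_integral f x b - f x (-b)) {-b..b}"
      by (rule fundamental_theorem_of_calculus)
        (use b f(2) in \<open>auto simp flip: has_real_derivative_iff_has_vector_derivative
            intro: has_field_derivative_at_within\<close>)
    then show ?thesis by (simp add: zero integral_unique)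
  qed
  then show "rect_integral (-a) a (-b) b f2 = 0" by (simp add: rect_integral_def)
qed

lemma C1_mult:
  assumes f: "C1 f f1 f2" and g: "C1 g g1 g2"
  shows "C1 (\<lambda>x y. f x y * g x y) (\<lambda>x y. f x y * g1 x y + g x y * f1 x y)
    (\<lambda>x y. f x y * g2 x y + g x y * f2 x y)"
proof -
  note f = C1D[OF f] and g = C1D[OF g]
  show ?thesis
    unfolding C1_def
  proof (intro conjI allI)
    show "((\<lambda>x. f x y * g x y) has_real_derivative f x y * g1 x y + g x y * f1 x y) (at x)" for x y
      using DERIV_mult[OF f(1)[of y x] g(1)[of y x]] by (simp add: mult.commute add.commute)
    show "((\<lambda>y. f x y * g x y) has_real_derivative f x y * g2 x y + g x y * f2 x y) (at y)" for x y
      using DERIV_mult[OF f(2)[of x y] g(2)[of x y]] by (simp add: mult.commute add.commute)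
  qed (intro cont2_binary f g)+
qed

text \<open>The hypotheses say that \<open>f\<close> is harmonic, with \<open>f\<^sub>x\<^sub>x = k f = - f\<^sub>y\<^sub>y\<close>, and that its outer normal derivative is
  \<open>\<mu> f\<close>. On each segment \<open>f\<^sub>x\<^sup>2 + k f\<^sup>2\<close> is the derivative of \<open>f f\<^sub>x\<close>, and likewise \<open>f\<^sub>y\<^sup>2 - k f\<^sup>2\<close> in the other
  direction; the terms with \<open>k\<close> cancel in the sum.\<close>

lemma Green_identity:
  assumes f: "C1 f f1 f2" and a: "0 < a" and b: "0 < b"
    and f11: "\<And>x y. ((\<lambda>x. f1 x y) has_real_derivative k * f x y) (at x)"
    and f22: "\<And>x y. (f2 x has_real_derivative - k * f x y) (at y)"
    and bc: "\<And>y. f1 a y = \<mu> * f a y" "\<And>y. f1 (-a) y = - \<mu> * f (-a) y"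
      "\<And>x. f2 x b = \<mu> * f x b" "\<And>x. f2 x (-b) = - \<mu> * f x (-b)"
  shows "rect_integral (-a) a (-b) b (\<lambda>x y. (f1 x y)\<^sup>2 + (f2 x y)\<^sup>2)
     = \<mu> * boundary_integral a b (\<lambda>x y. (f x y)\<^sup>2)"
proof -
  note f = C1D[OF f]
  let ?I = "rect_integral (-a) a (-b) b"
  have c: "cont2 (\<lambda>x y. (f1 x y)\<^sup>2 + k * (f x y)\<^sup>2)" "cont2 (\<lambda>x y. (f2 x y)\<^sup>2 + (- k) * (f x y)\<^sup>2)"
    by (intro cont2_binary cont2_power2 cont2_cmult f)+
  have i: "(\<lambda>y. (f t y)\<^sup>2) integrable_on {p..q}" "(\<lambda>x. (f x t)\<^sup>2) integrable_on {p..q}" for t p q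
    using integrable_slices(1,2)[OF cont2_power2[OF f(3)]] by auto
  have "integral {-a..a} (\<lambda>x. (f1 x y)\<^sup>2 + k * (f x y)\<^sup>2) = \<mu> * ((f a y)\<^sup>2 + (f (-a) y)\<^sup>2)" for y
  proof -
    have "((\<lambda>x. (f1 x y)\<^sup>2 + k * (f x y)\<^sup>2) has_integral f a y * f1 a y - f (-a) y * f1 (-a) y) {-a..a}"
    proof (rule fundamental_theorem_of_calculus)
      fix x
      have "((\<lambda>x. f x y * f1 x y) has_real_derivative (f1 x y)\<^sup>2 + k * (f x y)\<^sup>2) (at x)"
        using DERIV_mult[OF f(1)[of y x] f11[of y x]] by (simp add: power2_eq_square algebra_simps)
      then show "((\<lambda>x. f x y * f1 x y) has_vector_derivative (f1 x y)\<^sup>2 + k * (f x y)\<^sup>2) (at x within {-a..a})"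
        by (simp add: has_field_derivative_at_within flip: has_real_derivative_iff_has_vector_derivative)
    qed (use a in simp)
    then show ?thesis by (simp add: integral_unique bc power2_eq_square algebra_simps)
  qed
  then have 1: "?I (\<lambda>x y. (f1 x y)\<^sup>2 + k * (f x y)\<^sup>2)
      = \<mu> * (integral {-b..b} (\<lambda>y. (f a y)\<^sup>2) + integral {-b..b} (\<lambda>y. (f (-a) y)\<^sup>2))"
    by (simp add: rect_integral_swap[OF c(1)] Henstock_Kurzweil_Integration.integral_add i)
  have "integral {-b..b} (\<lambda>y. (f2 x y)\<^sup>2 + (- k) * (f x y)\<^sup>2) = \<mu> * ((f x b)\<^sup>2 + (f x (-b))\<^sup>2)" for x
  proof -
    have "((\<lambda>y. (f2 x y)\<^sup>2 + (- k) * (f x y)\<^sup>2) has_integral f x b * f2 x b - f x (-b) * f2 x (-b)) {-b..b}"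
    proof (rule fundamental_theorem_of_calculus)
      fix y
      have "((\<lambda>y. f x y * f2 x y) has_real_derivative (f2 x y)\<^sup>2 + (- k) * (f x y)\<^sup>2) (at y)"
        using DERIV_mult[OF f(2)[of x y] f22[of x y]] by (simp add: power2_eq_square algebra_simps)
      then show "((\<lambda>y. f x y * f2 x y) has_vector_derivative (f2 x y)\<^sup>2 + (- k) * (f x y)\<^sup>2) (at y within {-b..b})"
        by (simp add: has_field_derivative_at_within flip: has_real_derivative_iff_has_vector_derivative)
    qed (use b in simp)
    then show ?thesis by (simp add: integral_unique bc power2_eq_square algebra_simps)
  qed
  then have 2: "?I (\<lambda>x y. (f2 x y)\<^sup>2 + (- k) * (f x y)\<^sup>2)
      = \<mu> * (integral {-a..a} (\<lambda>x. (f x b)\<^sup>2) + integral {-a..a} (\<lambda>x. (f x (-b))\<^sup>2))"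
    by (simp add: rect_integral_def Henstock_Kurzweil_Integration.integral_add i)
  have "?I (\<lambda>x y. (f1 x y)\<^sup>2 + (f2 x y)\<^sup>2) =
      ?I (\<lambda>x y. ((f1 x y)\<^sup>2 + k * (f x y)\<^sup>2) + ((f2 x y)\<^sup>2 + (- k) * (f x y)\<^sup>2))"
    by (simp add: algebra_simps)
  also have "\<dots> = ?I (\<lambda>x y. (f1 x y)\<^sup>2 + k * (f x y)\<^sup>2) + ?I (\<lambda>x y. (f2 x y)\<^sup>2 + (- k) * (f x y)\<^sup>2)"
    by (rule rect_integral_add[OF c])
  finally show ?thesis unfolding 1 2 by (simp add: boundary_integral_def distrib_left)
qed

lemma boundary_integral_swap: "boundary_integral b a (\<lambda>x y. f y x) = boundary_integral a b f"
  by (simp add: boundary_integral_def)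

lemma C1_unique:
  assumes "C1 f f1 f2" "C1 f g1 g2"
  shows "f1 = g1" "f2 = g2"
  using DERIV_unique[OF C1D(1)[OF assms(1)] C1D(1)[OF assms(2)]]
    DERIV_unique[OF C1D(2)[OF assms(1)] C1D(2)[OF assms(2)]] by (auto simp: fun_eq_iff)

lemma C1_swap: "C1 f f1 f2 \<Longrightarrow> C1 (\<lambda>x y. f y x) (\<lambda>x y. f2 y x) (\<lambda>x y. f1 y x)"
  unfolding C1_def by (auto intro: cont2_swap)

lemma rect_integral_transpose:
  "cont2 f \<Longrightarrow> rect_integral c d a b (\<lambda>x y. f y x) = rect_integral a b c d f"
  using rect_integral_swap[of f] by (simp add: rect_integral_def)

context rectangle
begin

text \<open>The sum of the two integrands is the gradient of \<open>w \<phi>\<close>, which vanishes on the boundary because \<open>\<phi>\<close> has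
  its support inside the open rectangle.\<close>

lemma weak_gradient_smooth:
  assumes w: "smooth w"
  shows "weak_gradient \<Omega> w (gradient w)"
  unfolding weak_gradient_def
proof (intro allI impI)
  fix \<phi> assume "test_function \<Omega> \<phi>"
  then obtain K where \<phi>: "smooth \<phi>" and K: "K \<subseteq> \<Omega>" "\<And>z. z \<notin> K \<Longrightarrow> \<phi> z = 0"
    by (auto simp: test_function_def)
  have out: "\<phi> (x, y) = 0" if "(x, y) \<notin> \<Omega>" for x y using that K by blast
  note cw = continuous_on_smooth[OF w] continuous_on_gradient[OF w]
  note c\<phi> = continuous_on_smooth[OF \<phi>] continuous_on_gradient[OF \<phi>]
  let ?A = "\<lambda>z. w z *\<^sub>R gradient \<phi> z" and ?B = "\<lambda>z. \<phi> z *\<^sub>R gradient w z"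
  have cA: "continuous_on UNIV ?A" "continuous_on UNIV ?B"
    by (intro continuous_intros cw c\<phi>)+
  note P = C1_mult[OF C1_of_smooth[OF w] C1_of_smooth[OF \<phi>]]
  have Z: "rect_integral (-a) a (-b) b (\<lambda>x y. w (x, y) * partial_derivative \<phi> (1, 0) x y + \<phi> (x, y) * partial_derivative w (1, 0) x y) = 0"
    "rect_integral (-a) a (-b) b (\<lambda>x y. w (x, y) * partial_derivative \<phi> (0, 1) x y + \<phi> (x, y) * partial_derivative w (0, 1) x y) = 0"
    by (rule C1_integral_partials_zero[OF P a b]; simp add: out \<Omega>)+
  have c: "continuous_on UNIV (\<lambda>z. ?A z + ?B z)" by (intro continuous_on_add cA)
  have comp: "(LINT z:\<Omega>|lebesgue. ?A z + ?B z) \<bullet> v = (LINT z:\<Omega>|lebesgue. (?A z + ?B z) \<bullet> v)" for v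
    using integral_inner_left[of v lebesgue "\<lambda>z. indicator \<Omega> z *\<^sub>R (?A z + ?B z)"] set_integrable_\<Omega>[OF c]
    by (simp add: set_integrable_def set_lebesgue_integral_def)
  have c': "continuous_on UNIV (\<lambda>z. (?A z + ?B z) \<bullet> v)" for v by (intro continuous_intros c)
  have "(LINT z:\<Omega>|lebesgue. ?A z + ?B z) = 0"
  proof (rule euclidean_eqI)
    fix v :: "real \<times> real" assume "v \<in> Basis"
    then have "v = (1, 0) \<or> v = (0, 1)" by (auto simp: Basis_prod_def)
    then show "(LINT z:\<Omega>|lebesgue. ?A z + ?B z) \<bullet> v = 0 \<bullet> v"
      unfolding comp integral_\<Omega>[OF c'] using Z by (auto simp: gradient_prod)
  qed
  moreover have "(LINT z:\<Omega>|lebesgue. ?A z + ?B z) = (LINT z:\<Omega>|lebesgue. ?A z) + (LINT z:\<Omega>|lebesgue. ?B z)"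
    by (intro set_integral_add set_integrable_\<Omega> cA)
  ultimately show "(LINT z:\<Omega>|lebesgue. ?A z) = - (LINT z:\<Omega>|lebesgue. ?B z)"
    by (simp add: add_eq_0_iff2)
qed

text \<open>The constant sequence approximates a function that is smooth on the plane.\<close>

lemma smooth_has_trace:
  assumes w: "smooth w"
  shows "(w, gradient w) \<in> H1 \<Omega>" "has_trace \<Omega> (w, gradient w) w"
proof -
  show H: "(w, gradient w) \<in> H1 \<Omega>"
    by (simp add: H1_def weak_gradient_smooth L2_on_\<Omega> continuous_on_smooth continuous_on_gradient w)
  have "L2_on surface_measure (frontier \<Omega>) w"
    using L2_on_\<Gamma>[OF continuous_on_smooth[OF w]] by (simp add: \<Gamma>)
  then show "has_trace \<Omega> (w, gradient w) w"
    using H w unfolding has_trace_def by (auto intro!: exI[of _ "\<lambda>n. w"] simp: L2_norm_on_def)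
qed

lemma trace_inequality_sharp:
  assumes w: "smooth w" and C1: "C1 (\<lambda>x y. w (x, y)) w1 w2" and \<mu>: "0 < \<mu>"
    and mean: "boundary_integral a b (\<lambda>x y. w (x, y)) = 0"
    and pos: "0 < boundary_integral a b (\<lambda>x y. (w (x, y))\<^sup>2)"
    and eq: "rect_integral (-a) a (-b) b (\<lambda>x y. (w1 x y)\<^sup>2 + (w2 x y)\<^sup>2)
      = \<mu> * boundary_integral a b (\<lambda>x y. (w (x, y))\<^sup>2)"
    and C: "trace_inequality \<Omega> \<Gamma> C"
  shows "1 / sqrt \<mu> \<le> C"
proof -
  define N where "N = L2_norm_on surface_measure \<Gamma> w"
  have N2: "N\<^sup>2 = boundary_integral a b (\<lambda>x y. (w (x, y))\<^sup>2)"
    unfolding N_def by (rule L2_norm_\<Gamma>[OF continuous_on_smooth[OF w]])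
  have N: "0 < N" using N2 pos L2_norm_on_nonneg[of surface_measure \<Gamma> w]
    unfolding N_def by (metis less_eq_real_def power_zero_numeral less_irrefl)
  have "(L2_norm_on lebesgue \<Omega> (gradient w))\<^sup>2 = (sqrt \<mu> * N)\<^sup>2"
    unfolding L2_norm_gradient[OF w] C1_unique[OF C1_of_smooth[OF w] C1] eq using \<mu> by (simp add: power_mult_distrib N2)
  then have G: "L2_norm_on lebesgue \<Omega> (gradient w) = sqrt \<mu> * N"
    by (rule power2_eq_imp_eq) (use \<mu> N L2_norm_on_nonneg in auto)
  have "mean_value surface_measure \<Gamma> w = 0"
    using mean by (simp add: mean_value_def surface_integral(2)[OF continuous_on_smooth[OF w]])
  then have "N \<le> C * (sqrt \<mu> * N)"
    using C smooth_has_trace[OF w] unfolding trace_inequality_def N_def[symmetric] G[symmetric]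
    unfolding N_def by blast
  then have "N * 1 \<le> N * (C * sqrt \<mu>)" by (simp add: ac_simps)
  then have "1 \<le> C * sqrt \<mu>" using N by (simp only: mult_le_cancel_left_pos)
  then show ?thesis using \<mu> by (simp add: field_simps)
qed

end

text \<open>A family closed under differentiation up to a constant factor, which makes induction possible.\<close>

definition trig_hyp :: "(real \<Rightarrow> real) set" where
  "trig_hyp = {sin, cos, sinh, cosh}"

lemma trig_hyp_deriv:
  assumes "P \<in> trig_hyp"
  shows "\<exists>s. \<exists>P'\<in>trig_hyp. \<forall>x. (P has_real_derivative s * P' x) (at x)"
proof -
  have "\<forall>x. (sin has_real_derivative 1 * cos x) (at x)" "\<forall>x. (cos has_real_derivative -1 * sin x) (at x)"
    "\<forall>x. (sinh has_real_derivative 1 * cosh x) (at x)" "\<forall>x. (cosh has_real_derivative 1 * sinh x) (at x)"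
    for x :: real
    by (auto intro!: derivative_eq_intros)
  then show ?thesis using assms unfolding trig_hyp_def by blast
qed

text \<open>A partial derivative of such a product is again such a product with another constant \<open>c\<close>.\<close>

lemma smooth_trig_hyp_product:
  assumes "P \<in> trig_hyp" "Q \<in> trig_hyp"
  shows "smooth (\<lambda>z. c * P (\<beta> * fst z) * Q (\<beta> * snd z) :: real)"
  unfolding smooth_def
proof
  fix k
  show "C_k k (\<lambda>z. c * P (\<beta> * fst z) * Q (\<beta> * snd z) :: real)"
    using assms
  proof (induction k arbitrary: c P Q)
    case (0 c P Q)
    have cont: "continuous_on UNIV P" if "P \<in> trig_hyp" for P
      using that by (auto simp: trig_hyp_def intro!: continuous_intros)
    show ?case
      unfolding C_k.simps
      by (intro continuous_intros continuous_on_compose2[OF cont[OF 0(1)]]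
          continuous_on_compose2[OF cont[OF 0(2)]]) auto
  next
    case (Suc k c P Q)
    obtain P' s where P: "P' \<in> trig_hyp" "\<And>x. (P has_real_derivative s * P' x) (at x)"
      using trig_hyp_deriv[OF Suc.prems(1)] by blast
    obtain Q' t where Q: "Q' \<in> trig_hyp" "\<And>x. (Q has_real_derivative t * Q' x) (at x)"
      using trig_hyp_deriv[OF Suc.prems(2)] by blast
    let ?f = "\<lambda>z. c * P (\<beta> * fst z) * Q (\<beta> * snd z) :: real"
    have D: "(?f has_derivative (\<lambda>v. (c * \<beta> * s) * P' (\<beta> * fst z) * Q (\<beta> * snd z) * fst v
        + (c * \<beta> * t) * P (\<beta> * fst z) * Q' (\<beta> * snd z) * snd v)) (at z)" for z
    proof -
      have "((\<lambda>z. P (\<beta> * fst z)) has_derivative (\<lambda>v. s * P' (\<beta> * fst z) * (\<beta> * fst v))) (at z)"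
        by (rule has_derivative_compose[OF _ P(2)[unfolded has_field_derivative_def], of "\<lambda>z. \<beta> * fst z"])
          (auto intro!: derivative_eq_intros)
      moreover have "((\<lambda>z. Q (\<beta> * snd z)) has_derivative (\<lambda>v. t * Q' (\<beta> * snd z) * (\<beta> * snd v))) (at z)"
        by (rule has_derivative_compose[OF _ Q(2)[unfolded has_field_derivative_def], of "\<lambda>z. \<beta> * snd z"])
          (auto intro!: derivative_eq_intros)
      ultimately show ?thesis
        by (auto intro!: derivative_eq_intros simp: fun_eq_iff algebra_simps)
    qed
    have F: "frechet_derivative ?f (at z) = (\<lambda>v. (c * \<beta> * s) * P' (\<beta> * fst z) * Q (\<beta> * snd z) * fst v
        + (c * \<beta> * t) * P (\<beta> * fst z) * Q' (\<beta> * snd z) * snd v)" for z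
      using frechet_derivative_at[OF D] by simp
    have "?f differentiable (at z)" for z using D differentiableI by blast
    moreover have "C_k k (\<lambda>z. frechet_derivative ?f (at z) v)" if "v \<in> Basis" for v
    proof -
      from that have "v = (1, 0) \<or> v = (0, 1)" by (auto simp: Basis_prod_def)
      then show ?thesis
        using Suc.IH[OF P(1) Suc.prems(2), of "c * \<beta> * s"] Suc.IH[OF Suc.prems(1) Q(1), of "c * \<beta> * t"]
        by (auto simp: F)
    qed
    ultimately show ?case by simp
  qed
qed

section \<open>The transcendental equation\<close>

text \<open>Multiplied by \<open>cos (z \<alpha>)\<close>, the equation loses its singularity at \<open>z \<alpha> = \<pi>/2\<close> and the intermediate value
  theorem applies. Uniqueness holds because both factors are positive and strictly increasing.\<close>

lemma is_z0_unique_existence: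
  assumes \<alpha>: "\<alpha> > 0"
  shows "\<exists>!z. is_z0 \<alpha> z"
proof -
  define F where "F z = cos (z * \<alpha>) - tanh (z / \<alpha>) * sin (z * \<alpha>)" for z
  define e where "e = pi / 2 / \<alpha>"
  have e: "0 < e" "e * \<alpha> = pi / 2" using \<alpha> by (simp_all add: e_def)
  have "continuous_on {0..e} F"
    unfolding F_def[abs_def] by (intro continuous_intros) (use \<alpha> in auto)
  moreover have F0: "F 0 = 1" by (simp add: F_def)
  moreover have Fe: "F e < 0" unfolding F_def e(2) using e(1) \<alpha> by simp
  ultimately obtain z where z: "0 \<le> z" "z \<le> e" "F z = 0"
    using IVT2'[of F e 0 0] e by auto
  have z0: "0 < z" "z < e" using z F0 Fe by (auto simp: less_le)
  have "z * \<alpha> < e * \<alpha>" using z0 \<alpha> by simp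
  then have range: "0 < z * \<alpha>" "z * \<alpha> < pi / 2"
    using \<alpha> z0 by (simp_all only: e(2)) simp
  then have cos: "cos (z * \<alpha>) > 0" by (intro cos_gt_zero_pi) auto
  have eq: "tanh (z / \<alpha>) * sin (z * \<alpha>) = cos (z * \<alpha>)" using z(3) by (simp add: F_def)
  have "tanh (z / \<alpha>) * tan (z * \<alpha>) = 1"
    unfolding tan_def times_divide_eq_right eq using cos by simp
  then have ex: "is_z0 \<alpha> z" using range by (simp add: is_z0_def)
  have less: False if "is_z0 \<alpha> u" "is_z0 \<alpha> v" "u < v" for u v
  proof -
    have u: "0 < u * \<alpha>" and v: "v * \<alpha> < pi / 2" "u * \<alpha> < v * \<alpha>"
      using that \<alpha> by (auto simp: is_z0_def)
    have "tan (u * \<alpha>) < tan (v * \<alpha>)" "0 < tan (u * \<alpha>)"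
      using u v by (auto intro!: tan_monotone tan_gt_zero)
    moreover have "tanh (u / \<alpha>) < tanh (v / \<alpha>)" "0 < tanh (u / \<alpha>)"
      using u \<alpha> that(3) by (auto simp: divide_strict_right_mono zero_less_mult_iff)
    ultimately have "tanh (u / \<alpha>) * tan (u * \<alpha>) < tanh (v / \<alpha>) * tan (v * \<alpha>)"
      by (intro mult_strict_mono) auto
    then show False using that by (simp add: is_z0_def)
  qed
  show ?thesis
    using ex less by (metis linorder_neqE)
qed

lemma is_z0_z0: "\<alpha> > 0 \<Longrightarrow> is_z0 \<alpha> (z0 \<alpha>)"
  unfolding z0_def by (rule theI') (rule is_z0_unique_existence)

section \<open>The extremal function and the sharp constant\<close>

context critical
begin

text \<open>The Steklov eigenfunction for \<open>\<mu>\<close>, followed by its partial derivatives.\<close>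

definition mode :: "real \<Rightarrow> real \<Rightarrow> real" where
  "mode x y = sin (\<beta> * x) * cosh (\<beta> * y)"

definition mode1 :: "real \<Rightarrow> real \<Rightarrow> real" where
  "mode1 x y = \<beta> * cos (\<beta> * x) * cosh (\<beta> * y)"

definition mode2 :: "real \<Rightarrow> real \<Rightarrow> real" where
  "mode2 x y = \<beta> * sin (\<beta> * x) * sinh (\<beta> * y)"

lemma C1_mode: "C1 mode mode1 mode2"
  unfolding C1_def
proof (intro conjI allI)
  show "((\<lambda>x. mode x y) has_real_derivative mode1 x y) (at x)" for x y
    unfolding mode_def mode1_def by (auto intro!: derivative_eq_intros)
  show "(mode x has_real_derivative mode2 x y) (at y)" for x y
    unfolding mode_def[abs_def] mode2_def by (auto intro!: derivative_eq_intros)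
  show "cont2 mode" "cont2 mode1" "cont2 mode2"
    by (auto simp: case_prod_unfold mode_def mode1_def mode2_def intro!: continuous_intros)
qed

lemma mode_dirichlet_integral:
  "rect_integral (-a) a (-b) b (\<lambda>x y. (mode1 x y)\<^sup>2 + (mode2 x y)\<^sup>2)
     = \<mu> * boundary_integral a b (\<lambda>x y. (mode x y)\<^sup>2)"
proof (rule Green_identity[OF C1_mode a_pos ab(1)])
  show "((\<lambda>x. mode1 x y) has_real_derivative - \<beta>\<^sup>2 * mode x y) (at x)" for x y
    unfolding mode_def mode1_def by (auto intro!: derivative_eq_intros simp: power2_eq_square)
  show "(mode2 x has_real_derivative - (- \<beta>\<^sup>2) * mode x y) (at y)" for x y
    unfolding mode_def mode2_def[abs_def] by (auto intro!: derivative_eq_intros simp: power2_eq_square)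
  have "sin (\<beta> * a) \<noteq> 0" using sin_gt_zero2[OF _ \<beta>(2)] \<beta>(1) a_pos by force
  then have c: "\<beta> * cos (\<beta> * a) = \<mu> * sin (\<beta> * a)" by (simp add: \<mu>_cot cot_def)
  have "cosh (\<beta> * b) \<noteq> 0" by simp
  then have t: "\<beta> * sinh (\<beta> * b) = \<mu> * cosh (\<beta> * b)" by (simp add: \<mu>_tanh tanh_def)
  show "mode1 a y = \<mu> * mode a y" "mode1 (- a) y = - \<mu> * mode (- a) y" for y
    using c by (simp_all add: mode_def mode1_def)
  show "mode2 x b = \<mu> * mode x b" "mode2 x (- b) = - \<mu> * mode x (- b)" for x
    using t by (simp_all add: mode_def mode2_def)
qed

lemma mode_boundary_mean: "boundary_integral a b mode = 0"
proof -
  have "mode (- a) = (\<lambda>y. - mode a y)" by (simp add: mode_def fun_eq_iff)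
  moreover have "integral {-a..a} (\<lambda>x. mode x y) = 0" for y
    using integral_fold[OF less_imp_le[OF a_pos] cont2_slices(2)[OF C1D(3)[OF C1_mode]], of y]
    by (simp add: mode_def)
  ultimately show ?thesis by (simp add: boundary_integral_def)
qed

lemma mode_boundary_norm_pos: "0 < boundary_integral a b (\<lambda>x y. (mode x y)\<^sup>2)"
proof -
  note i = integrable_slices(1,2)[OF cont2_power2[OF C1D(3)[OF C1_mode]]]
  have s: "0 < sin (\<beta> * a)" by (rule sin_gt_zero2[OF _ \<beta>(2)]) (use \<beta>(1) a_pos in simp)
  have "integral {-b..b} (\<lambda>y. (sin (\<beta> * a))\<^sup>2) \<le> integral {-b..b} (\<lambda>y. (mode a y)\<^sup>2)"
  proof (rule integral_le)
    fix y
    have "sin (\<beta> * a) * 1 \<le> mode a y"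
      unfolding mode_def using s by (intro mult_left_mono cosh_real_ge_1) auto
    then show "(sin (\<beta> * a))\<^sup>2 \<le> (mode a y)\<^sup>2" using s by (intro power_mono) auto
  qed (use i in auto)
  moreover have "0 < integral {-b..b} (\<lambda>y. (sin (\<beta> * a))\<^sup>2)" using s ab by simp
  moreover have "0 \<le> integral {-b..b} (\<lambda>y. (mode (-a) y)\<^sup>2)" "0 \<le> integral {-a..a} (\<lambda>x. (mode x b)\<^sup>2)"
      "0 \<le> integral {-a..a} (\<lambda>x. (mode x (-b))\<^sup>2)"
    using i by (auto intro!: Henstock_Kurzweil_Integration.integral_nonneg)
  ultimately show ?thesis by (simp add: boundary_integral_def)
qed

end

text \<open>The longer side is horizontal, and the extremal function oscillates along it.\<close>

lemma is_C2_wide_rectangle: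
  assumes "rectangle a b \<Omega> \<Gamma>" and "critical a b \<beta> \<mu>"
  shows "is_C2 \<Omega> \<Gamma> (1 / sqrt \<mu>)"
proof -
  interpret rectangle a b \<Omega> \<Gamma> by fact
  interpret critical a b \<beta> \<mu> by fact
  let ?w = "\<lambda>z. 1 * sin (\<beta> * fst z) * cosh (\<beta> * snd z)"
  have w: "smooth ?w" by (rule smooth_trig_hyp_product) (auto simp: trig_hyp_def)
  have eq: "(\<lambda>x y. ?w (x, y)) = mode" by (simp add: mode_def fun_eq_iff)
  have C1: "C1 (\<lambda>x y. ?w (x, y)) mode1 mode2" unfolding eq by (rule C1_mode)
  show ?thesis
    unfolding is_C2_def
  proof (intro conjI allI impI)
    show "trace_inequality \<Omega> \<Gamma> (1 / sqrt \<mu>)"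
      by (rule trace_inequality_of_C1[OF \<mu>_pos rectangle_inequality])
    show "1 / sqrt \<mu> \<le> C" if "trace_inequality \<Omega> \<Gamma> C" for C
      by (rule trace_inequality_sharp[OF w C1 \<mu>_pos _ _ _ that])
        (use mode_boundary_mean mode_boundary_norm_pos mode_dirichlet_integral in \<open>simp_all add: mode_def[abs_def]\<close>)
  qed
qed

text \<open>The longer side is vertical; all two-dimensional statements are transferred by exchanging the
  variables.\<close>

lemma is_C2_tall_rectangle:
  assumes "rectangle a b \<Omega> \<Gamma>" and "critical b a \<beta> \<mu>"
  shows "is_C2 \<Omega> \<Gamma> (1 / sqrt \<mu>)"
proof -
  interpret rectangle a b \<Omega> \<Gamma> by fact
  interpret critical b a \<beta> \<mu> by fact
  let ?w = "\<lambda>z. 1 * cosh (\<beta> * fst z) * sin (\<beta> * snd z)"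
  have w: "smooth ?w" by (rule smooth_trig_hyp_product) (auto simp: trig_hyp_def)
  have eq: "(\<lambda>x y. ?w (x, y)) = (\<lambda>x y. mode y x)" by (simp add: mode_def fun_eq_iff mult.commute)
  have C1: "C1 (\<lambda>x y. ?w (x, y)) (\<lambda>x y. mode2 y x) (\<lambda>x y. mode1 y x)"
    unfolding eq by (rule C1_swap[OF C1_mode])
  have bi: "boundary_integral a b (\<lambda>x y. f y x) = boundary_integral b a f" for f
    using boundary_integral_swap[of a b f] by simp
  have ri: "rect_integral (-a) a (-b) b (\<lambda>x y. (f2 y x)\<^sup>2 + (f1 y x)\<^sup>2)
      = rect_integral (-b) b (-a) a (\<lambda>x y. (f1 x y)\<^sup>2 + (f2 x y)\<^sup>2)" if "cont2 f1" "cont2 f2" for f1 f2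
    using rect_integral_transpose[of "\<lambda>x y. (f1 x y)\<^sup>2 + (f2 x y)\<^sup>2" "-a" a "-b" b] that
    by (simp add: cont2_binary cont2_power2 add.commute)
  show ?thesis
    unfolding is_C2_def
  proof (intro conjI allI impI)
    show "trace_inequality \<Omega> \<Gamma> (1 / sqrt \<mu>)"
    proof (rule trace_inequality_of_C1[OF \<mu>_pos])
      fix f f1 f2 assume f: "C1 f f1 f2" and mean: "boundary_integral a b f = 0"
      have "\<mu> * boundary_integral b a (\<lambda>x y. (f y x)\<^sup>2)
          \<le> rect_integral (-b) b (-a) a (\<lambda>x y. (f2 y x)\<^sup>2 + (f1 y x)\<^sup>2)"
        by (rule rectangle_inequality[OF C1_swap[OF f]]) (use boundary_integral_swap[of b a f] mean in simp)
      then show "\<mu> * boundary_integral a b (\<lambda>x y. (f x y)\<^sup>2)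
          \<le> rect_integral (-a) a (-b) b (\<lambda>x y. (f1 x y)\<^sup>2 + (f2 x y)\<^sup>2)"
        using ri[OF cont2_swap[OF C1D(5)[OF f]] cont2_swap[OF C1D(4)[OF f]]]
          boundary_integral_swap[of b a "\<lambda>x y. (f x y)\<^sup>2"] by simp
    qed
    show "1 / sqrt \<mu> \<le> C" if "trace_inequality \<Omega> \<Gamma> C" for C
    proof (rule trace_inequality_sharp[OF w C1 \<mu>_pos _ _ _ that])
      have eq': "?w (x, y) = mode y x" for x y using fun_cong[OF fun_cong[OF eq]] by simp
      show "boundary_integral a b (\<lambda>x y. ?w (x, y)) = 0"
        unfolding eq' using mode_boundary_mean bi[of mode] by simp
      show "0 < boundary_integral a b (\<lambda>x y. (?w (x, y))\<^sup>2)"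
        unfolding eq' using mode_boundary_norm_pos bi[of "\<lambda>x y. (mode x y)\<^sup>2"] by simp
      show "rect_integral (-a) a (-b) b (\<lambda>x y. (mode2 y x)\<^sup>2 + (mode1 y x)\<^sup>2)
          = \<mu> * boundary_integral a b (\<lambda>x y. (?w (x, y))\<^sup>2)"
        unfolding eq' using mode_dirichlet_integral bi[of "\<lambda>x y. (mode x y)\<^sup>2"] ri[OF C1D(4,5)[OF C1_mode]] by simp
    qed
  qed
qed

text \<open>With \<open>M\<close> and \<open>m\<close> the longer and the shorter side, \<open>\<alpha>\<close> satisfies \<open>M = sqrt (M m) \<alpha>\<close> and
  \<open>m = sqrt (M m) / \<alpha>\<close>. The arguments \<open>z \<alpha>\<close> and \<open>z / \<alpha>\<close> are therefore \<open>\<beta>\<close> times the two half-widths.\<close>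

lemma critical_of_z0:
  assumes m: "0 < m" "m \<le> M" and \<alpha>: "\<alpha> = sqrt (M / m)" and z: "is_z0 \<alpha> z"
  shows "critical (M / 2) (m / 2) (2 * z / sqrt (M * m)) (2 * z / sqrt (M * m) * tanh (z / \<alpha>))"
proof -
  have M: "0 < M" using m by simp
  have \<alpha>0: "0 < \<alpha>" using m M by (simp add: \<alpha>)
  define s where "s = sqrt (M * m)"
  have s: "0 < s" using m M by (simp add: s_def)
  have "s * \<alpha> = sqrt ((M * m) * (M / m))" unfolding s_def \<alpha> by (rule real_sqrt_mult[symmetric])
  also have "(M * m) * (M / m) = M\<^sup>2" using m by (simp add: power2_eq_square)
  finally have M': "M = s * \<alpha>" using M by simp
  have "\<alpha> * \<alpha> = M / m" using m M by (simp add: \<alpha>)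
  then have "m * (\<alpha> * \<alpha>) = s * \<alpha>" using m M' by simp
  then have m': "s = m * \<alpha>" using \<alpha>0 by simp
  have z: "tanh (z / \<alpha>) * tan (z * \<alpha>) = 1" "0 < z * \<alpha>" "z * \<alpha> < pi / 2"
    using z by (auto simp: is_z0_def)
  have z0: "0 < z" using z(2) \<alpha>0 by (simp add: zero_less_mult_iff)
  have a: "2 * z / s * (M / 2) = z * \<alpha>" using s by (simp add: M')
  have b: "2 * z / s * (m / 2) = z / \<alpha>" using m \<alpha>0 by (simp add: m')
  have tan: "tanh (z / \<alpha>) = cot (z * \<alpha>)"
  proof -
    have "tan (z * \<alpha>) \<noteq> 0" using z(1) by auto
    then show ?thesis using z(1) by (simp add: cot_altdef field_simps)
  qed
  show ?thesis
    unfolding s_def[symmetric]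
    by unfold_locales (use m s z z0 tan in \<open>simp_all only: a b\<close>, auto)
qed

theorem theorem2p2:
  fixes h1 h2 \<alpha>0 :: real and \<Omega> \<Gamma> :: "(real \<times> real) set"
  assumes "h1 > 0" and "h2 > 0"
    and "\<Omega> = {- h1 / 2 <..< h1 / 2} \<times> {- h2 / 2 <..< h2 / 2}"
    and "\<Gamma> = frontier \<Omega>"
    and "\<alpha>0 = sqrt (max h1 h2 / min h1 h2)"
  shows "(\<forall>\<alpha>>0. \<exists>!z. is_z0 \<alpha> z) \<and>
    is_C2 \<Omega> \<Gamma> ((2 * z0 \<alpha>0 / sqrt (h1 * h2) * tanh (z0 \<alpha>0 / \<alpha>0)) powr (- 1 / 2))"
proof
  show "\<forall>\<alpha>>0. \<exists>!z. is_z0 \<alpha> z" using is_z0_unique_existence by blast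
  have rect: "rectangle (h1 / 2) (h2 / 2) \<Omega> \<Gamma>"
    by unfold_locales (use assms in simp_all)
  have "0 < \<alpha>0" using assms by simp
  then have z: "is_z0 \<alpha>0 (z0 \<alpha>0)" by (rule is_z0_z0)
  define \<mu> where "\<mu> = 2 * z0 \<alpha>0 / sqrt (h1 * h2) * tanh (z0 \<alpha>0 / \<alpha>0)"
  have C: "is_C2 \<Omega> \<Gamma> (1 / sqrt \<mu>) \<and> 0 < \<mu>"
  proof (cases "h2 \<le> h1")
    case True
    then have "critical (h1 / 2) (h2 / 2) (2 * z0 \<alpha>0 / sqrt (h1 * h2)) \<mu>"
      unfolding \<mu>_def using assms z by (intro critical_of_z0) (simp_all add: max_def min_def)
    then show ?thesis using is_C2_wide_rectangle[OF rect] critical.\<mu>_pos by blast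
  next
    case False
    then have "critical (h2 / 2) (h1 / 2) (2 * z0 \<alpha>0 / sqrt (h2 * h1)) \<mu>"
      unfolding \<mu>_def mult.commute[of h1 h2]
      using assms z by (intro critical_of_z0) (simp_all add: max_def min_def)
    then show ?thesis using is_C2_tall_rectangle[OF rect] critical.\<mu>_pos by blast
  qed
  then have "\<mu> powr (- 1 / 2) = 1 / sqrt \<mu>"
    by (simp add: powr_minus_divide powr_half_sqrt flip: minus_divide_left)
  with C show "is_C2 \<Omega> \<Gamma> ((2 * z0 \<alpha>0 / sqrt (h1 * h2) * tanh (z0 \<alpha>0 / \<alpha>0)) powr (- 1 / 2))"
    unfolding \<mu>_def[symmetric] by simp
qed

end
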